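(* Let $n\ge2$. The 2-form $\hat w_2$ on $\mathcal{M}_n(S^1)$, $$(\hat w_2)_\gamma(\delta_1\gamma,\delta_2\gamma)=\langle[\partial_x+b+u,\,g^{-1}\delta_1g],\,g^{-1}\delta_2g\rangle,$$ induces a weak symplectic form on the orbit space $\mathcal{M}_n(S^1)/SL(n,\mathbb{R})$.
   Context: $\mathcal{M}_n(S^1)$ is the set of smooth $\gamma:S^1\to\mathbb{R}^n\setminus\{0\}$ with $\det(\gamma,\gamma_x,\ldots,\gamma_x^{(n-1)})=1$, on which $SL(n,\mathbb{R})$ acts by $c\cdot\gamma=c\gamma$. The central affine moving frame $g=(\gamma,\gamma_x,\ldots,\gamma_x^{(n-1)})$ satisfies $g^{-1}g_x=b+u$, $b=\sum_{i=1}^{n-1}e_{i+1,i}$, $u=\sum_{i=1}^{n-1}u_ie_{in}$ the central affine curvature. Tangent vectors $\delta\gamma$ at $\gamma$ are the smooth maps $S^1\to\mathbb{R}^n$ satisfying the linearization of $\det(\gamma,\ldots,\gamma_x^{(n-1)})=1$; $\delta_i g=(\delta_i\gamma,(\delta_i\gamma)_x,\ldots,(\delta_i\gamma)_x^{(n-1)})$. $\langle\xi,\eta\rangle=\oint\mathrm{tr}(\xi\eta)\,dx$, $[\partial_x+A,B]=B_x+[A,B]$. A weak symplectic form on $M$ is a closed 2-form $w$ such that $w_x(v_1,v_2)=0$ for all $v_2\in TM_x$ implies $v_1=0$. That $\hat w_2$ induces a weak symplectic form on the orbit space means: $\hat w_2$ is closed and $SL(n,\mathbb{R})$-invariant, and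 for each $\gamma$ the null space $\{\delta_1\gamma:(\hat w_2)_\gamma(\delta_1\gamma,\delta_2\gamma)=0\ \forall\,\delta_2\gamma\}$ is exactly the tangent space $\{c_0\gamma: c_0\in sl(n,\mathbb{R})\}$ of the $SL(n,\mathbb{R})$-orbit through $\gamma$. *)

theory Defs
  imports "HOL-Analysis.Analysis"
begin

text \<open>Smoothness on an open set \<open>S\<close>: all iterated directional derivatives exist
  and are continuous.\<close>

primrec k_smooth_on :: "nat \<Rightarrow> 'a::real_normed_vector set \<Rightarrow> ('a \<Rightarrow> 'b::real_normed_vector) \<Rightarrow> bool" where
  "k_smooth_on 0 S f \<longleftrightarrow> continuous_on S f"
| "k_smooth_on (Suc k) S f \<longleftrightarrow>
     (\<forall>x\<in>S. f differentiable (at x)) \<and>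
     (\<forall>v. k_smooth_on k S (\<lambda>x. frechet_derivative f (at x) v))"

definition smooth_on :: "'a::real_normed_vector set \<Rightarrow> ('a \<Rightarrow> 'b::real_normed_vector) \<Rightarrow> bool" where
  "smooth_on S f \<longleftrightarrow> (\<forall>k. k_smooth_on k S f)"

text \<open>The circle is \<open>\<real> / 2\<pi>\<int>\<close>; maps on it are \<open>2\<pi>\<close>-periodic maps on \<open>\<real>\<close>.\<close>

definition smooth_loop :: "(real \<Rightarrow> 'a::real_normed_vector) \<Rightarrow> bool" where
  "smooth_loop f \<longleftrightarrow> smooth_on UNIV f \<and> (\<forall>x. f (x + 2 * pi) = f x)"

type_synonym 'n curve = "real \<Rightarrow> (real, 'n) vec"
type_synonym 'n sq_matrix = "((real, 'n) vec, 'n) vec"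
type_synonym 'n curve_form = "'n curve \<Rightarrow> 'n curve \<Rightarrow> 'n curve \<Rightarrow> real"

definition nth_vderiv :: "nat \<Rightarrow> (real \<Rightarrow> 'a::real_normed_vector) \<Rightarrow> real \<Rightarrow> 'a" where
  "nth_vderiv k f = ((\<lambda>h x. vector_derivative h (at x)) ^^ k) f"

text \<open>Rows and columns are indexed by a finite linear order with \<open>n\<close> elements; the index
  called \<open>k\<close> in \<open>1, \<dots>, n\<close> is the \<open>i\<close> with \<open>pos i = k - 1\<close>, and the index \<open>n\<close> is \<open>Max UNIV\<close>.\<close>

definition pos :: "'n::{finite,linorder} \<Rightarrow> nat" where
  "pos i = card {j. j < i}"

text \<open>The matrix with columns \<open>\<gamma>, \<gamma>\<^sub>x, \<dots>, \<gamma>\<^sub>x\<^bsup>(n-1)\<^esup>\<close>. Being linear in \<open>\<gamma>\<close>, it gives both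
  \<open>g = frame \<gamma>\<close> and \<open>\<delta>g = frame (\<delta>\<gamma>)\<close>.\<close>

definition frame :: "'n::{finite,linorder} curve \<Rightarrow> real \<Rightarrow> 'n sq_matrix" where
  "frame \<gamma> x = (\<chi> i j. nth_vderiv (pos j) \<gamma> x $ i)"

definition central_affine_curves :: "'n::{finite,linorder} curve set" where
  "central_affine_curves =
     {\<gamma>. smooth_loop \<gamma> \<and> (\<forall>x. \<gamma> x \<noteq> 0) \<and> (\<forall>x. det (frame \<gamma> x) = 1)}"

definition tangent_at ::
  "'n::{finite,linorder} curve \<Rightarrow> 'n curve set" where
  "tangent_at \<gamma> =
     {v. smooth_loop v \<and>
         (\<forall>x. ((\<lambda>s. det (frame (\<lambda>y. \<gamma> y + s *\<^sub>R v y) x)) has_real_derivative 0) (at 0))}"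

definition b_mat :: "'n::{finite,linorder} sq_matrix" where
  "b_mat = (\<chi> i j. if pos i = Suc (pos j) then 1 else 0)"

text \<open>The functions \<open>u\<^sub>i\<close>, \<open>i < n\<close>, are read off from the last column of \<open>g\<^sup>-\<^sup>1 g\<^sub>x\<close>.\<close>

definition curvature ::
  "'n::{finite,linorder} curve \<Rightarrow> real \<Rightarrow> 'n sq_matrix" where
  "curvature \<gamma> x =
     (\<chi> i j. if j = Max UNIV \<and> i \<noteq> Max UNIV
             then (matrix_inv (frame \<gamma> x) ** vector_derivative (frame \<gamma>) (at x)) $ i $ j
             else 0)"

text \<open>\<open>[\<partial>\<^sub>x + A, B] = B\<^sub>x + [A, B]\<close>.\<close>

definition conn_bracket ::
  "(real \<Rightarrow> 'n::finite sq_matrix) \<Rightarrow> (real \<Rightarrow> 'n sq_matrix) \<Rightarrow> real \<Rightarrow> 'n sq_matrix" where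
  "conn_bracket A B x = vector_derivative B (at x) + (A x ** B x - B x ** A x)"

definition loop_pairing ::
  "(real \<Rightarrow> 'n::finite sq_matrix) \<Rightarrow> (real \<Rightarrow> 'n sq_matrix) \<Rightarrow> real" where
  "loop_pairing \<xi> \<eta> = integral {0..2 * pi} (\<lambda>x. trace (\<xi> x ** \<eta> x))"

definition w2_hat :: "'n::{finite,linorder} curve_form" where
  "w2_hat \<gamma> v\<^sub>1 v\<^sub>2 =
     loop_pairing
       (conn_bracket (\<lambda>x. b_mat + curvature \<gamma> x) (\<lambda>x. matrix_inv (frame \<gamma> x) ** frame v\<^sub>1 x))
       (\<lambda>x. matrix_inv (frame \<gamma> x) ** frame v\<^sub>2 x)"

text \<open>Differential forms on the space of curves are tested on smooth finite-dimensional families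
  of curves. Three parameters suffice: \<open>\<beta> \<mapsto> det(\<beta>, \<dots>, \<beta>\<^sub>x\<^bsup>(n-1)\<^esup>)\<^bsup>-1/n\<^esup> \<beta>\<close> is a smooth
  retraction of the open set of loops with positive determinant onto the space of curves, so any
  three tangent vectors at \<open>\<gamma>\<close> are the partial derivatives of such a family through \<open>\<gamma>\<close>, and any
  smooth curve \<open>\<tau> \<mapsto> (\<gamma>, v\<^sub>1, v\<^sub>2)\<close> of pairs of tangent vectors arises from one as well.\<close>

definition smooth_family ::
  "(real^3) set \<Rightarrow> (real^3 \<Rightarrow> 'n::{finite,linorder} curve) \<Rightarrow> bool" where
  "smooth_family U \<Gamma> \<longleftrightarrow>
     open U \<and> smooth_on (U \<times> UNIV) (\<lambda>(p, x). \<Gamma> p x) \<and> (\<forall>p\<in>U. \<Gamma> p \<in> central_affine_curves)"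

definition variation ::
  "(real^3 \<Rightarrow> 'n::finite curve) \<Rightarrow> real^3 \<Rightarrow> real^3 \<Rightarrow> 'n curve" where
  "variation \<Gamma> p a x = frechet_derivative (\<lambda>q. \<Gamma> q x) (at p) a"

definition pullback_form ::
  "(real^3 \<Rightarrow> 'n::finite curve) \<Rightarrow> 'n curve_form \<Rightarrow> real^3 \<Rightarrow> real^3 \<Rightarrow> real^3 \<Rightarrow> real" where
  "pullback_form \<Gamma> w p a b = w (\<Gamma> p) (variation \<Gamma> p a) (variation \<Gamma> p b)"

definition is_two_form :: "'n::{finite,linorder} curve_form \<Rightarrow> bool" where
  "is_two_form w \<longleftrightarrow>
     (\<forall>\<gamma>\<in>central_affine_curves. \<forall>v\<^sub>1\<in>tangent_at \<gamma>. \<forall>v\<^sub>2\<in>tangent_at \<gamma>. \<forall>v\<^sub>3\<in>tangent_at \<gamma>. \<forall>c d.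
        w \<gamma> (\<lambda>x. c *\<^sub>R v\<^sub>1 x + d *\<^sub>R v\<^sub>2 x) v\<^sub>3 = c * w \<gamma> v\<^sub>1 v\<^sub>3 + d * w \<gamma> v\<^sub>2 v\<^sub>3 \<and>
        w \<gamma> v\<^sub>1 v\<^sub>2 = - w \<gamma> v\<^sub>2 v\<^sub>1) \<and>
     (\<forall>U \<Gamma>. smooth_family U \<Gamma> \<longrightarrow> (\<forall>a b. smooth_on U (\<lambda>p. pullback_form \<Gamma> w p a b)))"

text \<open>The left-hand side of the equation is \<open>d(\<Gamma>\<^sup>*w)\<close> at \<open>p\<close>, evaluated on the constant vector
  fields \<open>a\<close>, \<open>b\<close>, \<open>c\<close>.\<close>

definition is_closed_two_form :: "'n::{finite,linorder} curve_form \<Rightarrow> bool" where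
  "is_closed_two_form w \<longleftrightarrow>
     is_two_form w \<and>
     (\<forall>U \<Gamma>. smooth_family U \<Gamma> \<longrightarrow> (\<forall>p\<in>U. \<forall>a b c.
        frechet_derivative (\<lambda>q. pullback_form \<Gamma> w q b c) (at p) a +
        frechet_derivative (\<lambda>q. pullback_form \<Gamma> w q c a) (at p) b +
        frechet_derivative (\<lambda>q. pullback_form \<Gamma> w q a b) (at p) c = 0))"

definition SL_invariant :: "'n::{finite,linorder} curve_form \<Rightarrow> bool" where
  "SL_invariant w \<longleftrightarrow>
     (\<forall>c. det c = 1 \<longrightarrow>
       (\<forall>\<gamma>\<in>central_affine_curves. \<forall>v\<^sub>1\<in>tangent_at \<gamma>. \<forall>v\<^sub>2\<in>tangent_at \<gamma>.
          w (\<lambda>x. c *v \<gamma> x) (\<lambda>x. c *v v\<^sub>1 x) (\<lambda>x. c *v v\<^sub>2 x) = w \<gamma> v\<^sub>1 v\<^sub>2))"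

definition null_space ::
  "'n::{finite,linorder} curve_form \<Rightarrow> 'n curve \<Rightarrow> 'n curve set" where
  "null_space w \<gamma> = {v\<^sub>1 \<in> tangent_at \<gamma>. \<forall>v\<^sub>2\<in>tangent_at \<gamma>. w \<gamma> v\<^sub>1 v\<^sub>2 = 0}"

definition orbit_tangent_at ::
  "'n::{finite,linorder} curve \<Rightarrow> 'n curve set" where
  "orbit_tangent_at \<gamma> = {(\<lambda>x. c\<^sub>0 *v \<gamma> x) | c\<^sub>0. trace c\<^sub>0 = 0}"

definition induces_weak_symplectic_form :: "'n::{finite,linorder} curve_form \<Rightarrow> bool" where
  "induces_weak_symplectic_form w \<longleftrightarrow>
     is_closed_two_form w \<and> SL_invariant w \<and>
     (\<forall>\<gamma>\<in>central_affine_curves. null_space w \<gamma> = orbit_tangent_at \<gamma>)"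

end

theory Submission
  imports Defs
begin

text \<open>
  Put \<open>\<eta>\<^sub>i = \<delta>\<^sub>i g g\<^sup>-\<^sup>1\<close>. Since \<open>g\<^sup>-\<^sup>1 g\<^sub>x = b + u\<close>, the bracket \<open>[\<partial>\<^sub>x + b + u, g\<^sup>-\<^sup>1 \<delta>\<^sub>1 g]\<close> equals
  \<open>g\<^sup>-\<^sup>1 (\<eta>\<^sub>1)\<^sub>x g\<close>, so the form is \<open>\<oint> tr ((\<eta>\<^sub>1)\<^sub>x \<eta>\<^sub>2) dx\<close>. It is skew by integration by parts, and closed
  because the Maurer-Cartan equation for \<open>dg g\<^sup>-\<^sup>1\<close> turns the integrand of its exterior derivative into
  an \<open>x\<close>-derivative of a periodic function. If \<open>\<delta>\<^sub>1\<gamma>\<close> is in the null space, suitable test vectors show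
  that the bracket is zero; then \<open>\<eta>\<^sub>1\<close> is a constant \<open>c\<^sub>0\<close>, which means \<open>\<delta>\<^sub>1\<gamma> = c\<^sub>0 \<gamma>\<close>.
\<close>

section \<open>Calculus of smooth maps\<close>

text \<open>Two facts shape the nondegeneracy argument. The columns of \<open>\<delta>g\<close> are
  successive derivatives of \<open>\<delta>\<gamma>\<close>, so \<open>(\<delta>g)_x\<close> and
  \<open>\<delta>g (b+u)\<close> agree in every column but the last; the pairing therefore sees only
  the last row of \<open>g^-1 \<delta>_2 g\<close>. And \<open>\<delta>_2 \<gamma>\<close> is not
  free: tangency means \<open>tr (g^-1 \<delta>_2 g) = 0\<close>, so a periodic vector field can be
  prescribed only up to a multiple \<open>h \<gamma>\<close>, with \<open>h\<close> determined by
  the rest. The curvature records the last column of \<open>g^-1 g_x\<close> with its bottom entry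
  replaced by 0. That nothing is lost is the identity \<open>tr (g^-1 g_x) = 0\<close>, the
  derivative of \<open>det g = 1\<close>. Closedness mixes derivatives in x with derivatives in the
  parameters of a family. It needs these to commute, the integral to be differentiable in the
  parameters, and \<open>g^-1\<close> to be smooth in all variables jointly. Since smoothness is
  defined by iterated directional derivatives, the calculus is developed for the operators
  \<open>dderiv v\<close>, which can be iterated like any other map on functions.\<close>

definition dderiv :: "'a::real_normed_vector \<Rightarrow> ('a \<Rightarrow> 'b::real_normed_vector) \<Rightarrow> 'a \<Rightarrow> 'b" where
  "dderiv v f x = frechet_derivative f (at x) v"

lemma dderiv_eq: "(f has_derivative f') (at x) \<Longrightarrow> dderiv v f x = f' v"
  unfolding dderiv_def using frechet_derivative_at by metis

lemma has_derivative_dderiv: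
  "f differentiable (at x) \<Longrightarrow> (f has_derivative (\<lambda>v. dderiv v f x)) (at x)"
  unfolding dderiv_def by (simp add: frechet_derivative_works)

section \<open>Maps that are smooth to a finite order\<close>

lemma k_smooth_on_Suc:
  "k_smooth_on (Suc k) S f \<longleftrightarrow> (\<forall>x\<in>S. f differentiable (at x)) \<and> (\<forall>v. k_smooth_on k S (dderiv v f))"
  by (simp add: dderiv_def[abs_def])

lemma differentiable_cong_open:
  assumes "open S" "x \<in> S" "\<And>x. x \<in> S \<Longrightarrow> f x = g x" "f differentiable (at x)"
  shows "g differentiable (at x)"
  using assms has_derivative_transform_within_open unfolding differentiable_def by metis

lemma dderiv_cong_open:
  assumes "open S" "x \<in> S" "\<And>x. x \<in> S \<Longrightarrow> f x = g x" "f differentiable (at x)"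
  shows "dderiv v f x = dderiv v g x"
  unfolding dderiv_def using frechet_derivative_transform_within_open[OF assms(4,1,2,3)] by simp

text \<open>A derivative at a point depends on nearby values, so agreement on \<open>S\<close>
  passes to derivatives because \<open>S\<close> is open. Every later induction uses this to replace
  the derivative of a composite by its explicit formula, which is known on \<open>S\<close>
  only.\<close>

lemma k_smooth_on_cong:
  assumes "open S" "\<And>x. x \<in> S \<Longrightarrow> f x = g x" "k_smooth_on k S f"
  shows "k_smooth_on k S g"
  using assms(2,3)
proof (induction k arbitrary: f g)
  case 0
  then show ?case by (simp cong: continuous_on_cong)
next
  case (Suc k)
  have d: "\<forall>x\<in>S. f differentiable (at x)" and s: "k_smooth_on k S (dderiv v f)" for v
    using Suc.prems(2) unfolding k_smooth_on_Suc by auto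
  have "k_smooth_on k S (dderiv v g)" for v
    by (rule Suc.IH[OF _ s]) (use d dderiv_cong_open[OF assms(1)] Suc.prems(1) in blast)
  then show ?case
    unfolding k_smooth_on_Suc using d Suc.prems(1) differentiable_cong_open[OF assms(1)] by blast
qed

text \<open>The product rule puts an undifferentiated factor beside a differentiated one; this
  brings both to the same order.\<close>

lemma k_smooth_on_SucD: "k_smooth_on (Suc k) S f \<Longrightarrow> k_smooth_on k S f"
proof (induction k arbitrary: f)
  case 0
  then have "\<forall>x\<in>S. f differentiable (at x)" unfolding k_smooth_on_Suc by blast
  then have "\<forall>x\<in>S. isCont f x" using differentiable_imp_continuous_within by blast
  then show ?case unfolding k_smooth_on.simps by (rule continuous_at_imp_continuous_on)
next
  case (Suc k)
  show ?case
    unfolding k_smooth_on_Suc[of k] using Suc.prems Suc.IH unfolding k_smooth_on_Suc[of "Suc k"] by simp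
qed

lemma k_smooth_on_const: "k_smooth_on k S (\<lambda>x. c)"
proof (induction k arbitrary: c)
  case (Suc k)
  have "dderiv v (\<lambda>x::'a. c) = (\<lambda>x. 0)" for v
    by (auto simp: dderiv_def)
  then show ?case unfolding k_smooth_on_Suc using Suc by simp
qed simp

lemma k_smooth_on_add:
  assumes "open S" "k_smooth_on k S f" "k_smooth_on k S g"
  shows "k_smooth_on k S (\<lambda>x. f x + g x)"
  using assms(2,3)
proof (induction k arbitrary: f g)
  case 0
  then show ?case by (auto intro: continuous_intros)
next
  case (Suc k)
  have d: "\<forall>x\<in>S. f differentiable (at x)" "\<forall>x\<in>S. g differentiable (at x)"
    using Suc.prems unfolding k_smooth_on_Suc by auto
  have F: "((\<lambda>x. f x + g x) has_derivative (\<lambda>v. dderiv v f x + dderiv v g x)) (at x)" if "x \<in> S" for x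
    by (rule has_derivative_add) (use d that in \<open>auto intro: has_derivative_dderiv\<close>)
  have "k_smooth_on k S (\<lambda>x. dderiv v f x + dderiv v g x)" for v
    using Suc.prems unfolding k_smooth_on_Suc by (intro Suc.IH) simp_all
  then have "k_smooth_on k S (dderiv v (\<lambda>x. f x + g x))" for v
    by (rule k_smooth_on_cong[OF assms(1), rotated]) (simp add: dderiv_eq[OF F])
  then show ?case unfolding k_smooth_on_Suc using d by (auto intro: differentiable_add)
qed

text \<open>The derivative of a product is a sum of two products, each with one factor of lower
  order, so the induction closes. An arbitrary bounded bilinear map covers scalar, matrix and trace
  products at once.\<close>

lemma k_smooth_on_bilinear:
  assumes "open S" "bounded_bilinear mul" "k_smooth_on k S f" "k_smooth_on k S g"
  shows "k_smooth_on k S (\<lambda>x. mul (f x) (g x))"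
  using assms(3,4)
proof (induction k arbitrary: f g)
  case 0
  then show ?case by (auto intro: bounded_bilinear.continuous_on[OF assms(2)])
next
  case (Suc k)
  have d: "\<forall>x\<in>S. f differentiable (at x)" "\<forall>x\<in>S. g differentiable (at x)"
    using Suc.prems unfolding k_smooth_on_Suc by auto
  have F: "((\<lambda>x. mul (f x) (g x)) has_derivative
          (\<lambda>v. mul (f x) (dderiv v g x) + mul (dderiv v f x) (g x))) (at x)" if "x \<in> S" for x
    by (rule bounded_bilinear.FDERIV[OF assms(2)]) (use d that in \<open>auto intro: has_derivative_dderiv\<close>)
  have "k_smooth_on k S (\<lambda>x. mul (f x) (dderiv v g x) + mul (dderiv v f x) (g x))" for v
    using Suc.prems k_smooth_on_SucD[OF Suc.prems(1)] k_smooth_on_SucD[OF Suc.prems(2)]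
    unfolding k_smooth_on_Suc by (intro k_smooth_on_add[OF assms(1)] Suc.IH) simp_all
  then have "k_smooth_on k S (dderiv v (\<lambda>x. mul (f x) (g x)))" for v
    by (rule k_smooth_on_cong[OF assms(1), rotated]) (simp add: dderiv_eq[OF F])
  then show ?case unfolding k_smooth_on_Suc using F unfolding differentiable_def by blast
qed

text \<open>For an affine inner map the chain rule only changes the direction from \<open>v\<close>
  to \<open>L v\<close> and creates no products, so the induction stays within compositions with the
  same map.\<close>

lemma k_smooth_on_affine_compose:
  assumes "open R" "bounded_linear L" "k_smooth_on k S f" "\<And>x. x \<in> R \<Longrightarrow> c + L x \<in> S"
  shows "k_smooth_on k R (\<lambda>x. f (c + L x))"
  using assms(3)
proof (induction k arbitrary: f)
  case 0
  have "continuous_on R (\<lambda>x. c + L x)"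
    using assms(2) by (intro continuous_intros linear_continuous_on)
  then show ?case using 0 assms(4) by (auto intro: continuous_on_compose2)
next
  case (Suc k)
  have F: "((\<lambda>x. f (c + L x)) has_derivative (\<lambda>v. dderiv (L v) f (c + L x))) (at x)" if "x \<in> R" for x
  proof -
    have "(f has_derivative (\<lambda>v. dderiv v f (c + L x))) (at (c + L x))"
      using Suc.prems assms(4)[OF that] unfolding k_smooth_on_Suc by (auto intro: has_derivative_dderiv)
    then show ?thesis
      by (rule has_derivative_compose[rotated, where f = "\<lambda>x. c + L x"])
        (auto intro!: derivative_eq_intros bounded_linear.has_derivative[OF assms(2)])
  qed
  have "k_smooth_on k R (\<lambda>x. dderiv (L v) f (c + L x))" for v
    using Suc.prems unfolding k_smooth_on_Suc by (intro Suc.IH) simp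
  then have "k_smooth_on k R (dderiv v (\<lambda>x. f (c + L x)))" for v
    by (rule k_smooth_on_cong[OF assms(1), rotated]) (simp add: dderiv_eq[OF F])
  then show ?case unfolding k_smooth_on_Suc using F unfolding differentiable_def by blast
qed

section \<open>Closure properties of smooth maps\<close>

lemma smooth_on_cong:
  "open S \<Longrightarrow> (\<And>x. x \<in> S \<Longrightarrow> f x = g x) \<Longrightarrow> smooth_on S f \<Longrightarrow> smooth_on S g"
  unfolding smooth_on_def by (intro allI, rule k_smooth_on_cong[of S f g]) auto

lemma smooth_on_const: "smooth_on S (\<lambda>x. c)"
  unfolding smooth_on_def by (intro allI k_smooth_on_const)

lemma smooth_on_add:
  "open S \<Longrightarrow> smooth_on S f \<Longrightarrow> smooth_on S g \<Longrightarrow> smooth_on S (\<lambda>x. f x + g x)"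
  unfolding smooth_on_def by (intro allI, rule k_smooth_on_add) auto

lemma smooth_on_bilinear:
  "open S \<Longrightarrow> bounded_bilinear mul \<Longrightarrow> smooth_on S f \<Longrightarrow> smooth_on S g \<Longrightarrow> smooth_on S (\<lambda>x. mul (f x) (g x))"
  unfolding smooth_on_def by (intro allI, rule k_smooth_on_bilinear[of S mul _ f g]) auto

lemma smooth_on_affine_compose:
  "open R \<Longrightarrow> bounded_linear L \<Longrightarrow> smooth_on S f \<Longrightarrow> (\<And>x. x \<in> R \<Longrightarrow> c + L x \<in> S) \<Longrightarrow>
   smooth_on R (\<lambda>x. f (c + L x))"
  unfolding smooth_on_def by (intro allI, rule k_smooth_on_affine_compose[of R L _ S f c]) auto

text \<open>A linear map is the bilinear map \<open>r *\<^sub>R L y\<close> with \<open>r\<close>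
  held at the constant 1, so the product case applies.\<close>

lemma smooth_on_linear:
  assumes "open S" "bounded_linear L" "smooth_on S f"
  shows "smooth_on S (\<lambda>x. L (f x))"
proof -
  have "bounded_bilinear (\<lambda>(r::real) y. r *\<^sub>R L y)"
    using bounded_bilinear.comp[OF bounded_bilinear_scaleR bounded_linear_ident assms(2)] by simp
  from smooth_on_bilinear[OF assms(1) this smooth_on_const assms(3), of 1] show ?thesis by simp
qed

lemma smooth_on_sum:
  "open S \<Longrightarrow> (\<And>i. i \<in> I \<Longrightarrow> smooth_on S (f i)) \<Longrightarrow> smooth_on S (\<lambda>x. \<Sum>i\<in>I. f i x)"
  by (induction I rule: infinite_finite_induct) (simp_all add: smooth_on_const smooth_on_add)

lemma smooth_on_prod:
  fixes f :: "'i \<Rightarrow> 'a::real_normed_vector \<Rightarrow> real"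
  shows "open S \<Longrightarrow> (\<And>i. i \<in> I \<Longrightarrow> smooth_on S (f i)) \<Longrightarrow> smooth_on S (\<lambda>x. \<Prod>i\<in>I. f i x)"
  by (induction I rule: infinite_finite_induct)
    (simp_all add: smooth_on_const smooth_on_bilinear[OF _ bounded_bilinear_mult])

lemma smooth_on_vec_lambda:
  fixes f :: "'i::finite \<Rightarrow> 'a::real_normed_vector \<Rightarrow> 'b::euclidean_space"
  assumes "open S" "\<And>i. smooth_on S (f i)"
  shows "smooth_on S (\<lambda>x. \<chi> i. f i x)"
proof -
  have "bounded_linear (axis i :: 'b \<Rightarrow> 'b ^ 'i)" for i
    unfolding linear_conv_bounded_linear[symmetric] by (rule linearI) (auto simp: vec_eq_iff axis_def)
  from smooth_on_linear[OF assms(1) this assms(2)]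
  have "smooth_on S (\<lambda>x. axis i (f i x) :: 'b ^ 'i)" for i .
  then have "smooth_on S (\<lambda>x. \<Sum>i\<in>UNIV. axis i (f i x))"
    by (rule smooth_on_sum[OF assms(1)])
  moreover have "(\<Sum>i\<in>UNIV. axis i (f i x)) = (\<chi> i. f i x)" for x
    by (simp add: vec_eq_iff axis_def)
  ultimately show ?thesis by simp
qed

lemma smooth_on_vec_nth:
  fixes f :: "'a::real_normed_vector \<Rightarrow> 'b::real_normed_vector ^ 'i::finite"
  shows "open S \<Longrightarrow> smooth_on S f \<Longrightarrow> smooth_on S (\<lambda>x. f x $ i)"
  using smooth_on_linear[OF _ bounded_linear_vec_nth] .

lemma smooth_on_imp_differentiable: "smooth_on S f \<Longrightarrow> x \<in> S \<Longrightarrow> f differentiable (at x)"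
  unfolding smooth_on_def by (drule spec[of _ 1]) simp

lemma smooth_on_imp_continuous_on: "smooth_on S f \<Longrightarrow> continuous_on S f"
  unfolding smooth_on_def by (drule spec[of _ 0]) simp

lemma smooth_on_dderiv: "smooth_on S f \<Longrightarrow> smooth_on S (dderiv v f)"
  unfolding smooth_on_def by (metis k_smooth_on_Suc)

lemma smooth_on_has_derivative:
  "smooth_on S f \<Longrightarrow> x \<in> S \<Longrightarrow> (f has_derivative (\<lambda>v. dderiv v f x)) (at x)"
  by (blast intro: has_derivative_dderiv smooth_on_imp_differentiable)

lemma smooth_on_dderiv_bilinear:
  assumes "bounded_bilinear mul" "smooth_on S f" "smooth_on S g" "x \<in> S"
  shows "dderiv v (\<lambda>x. mul (f x) (g x)) x = mul (f x) (dderiv v g x) + mul (dderiv v f x) (g x)"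
  using dderiv_eq[OF bounded_bilinear.FDERIV[OF assms(1) smooth_on_has_derivative[OF assms(2,4)]
      smooth_on_has_derivative[OF assms(3,4)]]] .

lemma smooth_on_has_vector_derivative_line:
  assumes "smooth_on S f" "z + s *\<^sub>R v \<in> S"
  shows "((\<lambda>s. f (z + s *\<^sub>R v)) has_vector_derivative dderiv v f (z + s *\<^sub>R v)) (at s)"
proof -
  have d: "(f has_derivative (\<lambda>u. dderiv u f (z + s *\<^sub>R v))) (at (z + s *\<^sub>R v))"
    using smooth_on_has_derivative[OF assms] .
  have "((\<lambda>s. f (z + s *\<^sub>R v)) has_derivative (\<lambda>t. dderiv (t *\<^sub>R v) f (z + s *\<^sub>R v))) (at s)"
    using d by (rule has_derivative_compose[rotated, where f = "\<lambda>s. z + s *\<^sub>R v"])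
      (auto intro!: derivative_eq_intros)
  moreover have "dderiv (t *\<^sub>R v) f (z + s *\<^sub>R v) = t *\<^sub>R dderiv v f (z + s *\<^sub>R v)" for t
    using linear_simps(5)[OF has_derivative_bounded_linear[OF d]] .
  ultimately show ?thesis by (simp add: has_vector_derivative_def)
qed

text \<open>Differentiating \<open>f (x + s v + t w) - f (x + s v) = \<integral>\<^sub>0\<^sup>t (\<partial>\<^sub>w f) (x + s v + \<tau> w) d\<tau>\<close> at \<open>s = 0\<close>
  under the integral and then at \<open>t = 0\<close> gives the symmetry of second derivatives.\<close>

lemma dderiv_commute:
  fixes f :: "'a::real_normed_vector \<Rightarrow> 'b::banach"
  assumes "open S" "smooth_on S f" "x \<in> S"
  shows "dderiv v (dderiv w f) x = dderiv w (dderiv v f) x"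
proof -
  obtain r where r: "r > 0" "ball x r \<subseteq> S" using assms(1,3) open_contains_ball by blast
  \<comment> \<open>For \<open>\<bar>s\<bar>\<close> and \<open>\<bar>t\<bar>\<close> at most
    \<open>e\<close> the displacement \<open>s v + t w\<close> has norm less than \<open>r\<close>.
    The summand 1 makes this strict and keeps the denominator positive when \<open>v\<close> and
    \<open>w\<close> vanish.\<close>
  define e where "e = r / (norm v + norm w + 1)"
  have nn: "norm v + norm w + 1 > 0" by (simp add: add_nonneg_pos)
  have e: "e > 0" unfolding e_def using r(1) nn by simp
  have inS: "x + s *\<^sub>R v + t *\<^sub>R w \<in> S" if "\<bar>s\<bar> \<le> e" "\<bar>t\<bar> \<le> e" for s t
  proof -
    have "norm (s *\<^sub>R v + t *\<^sub>R w) \<le> \<bar>s\<bar> * norm v + \<bar>t\<bar> * norm w"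
      by (metis norm_scaleR norm_triangle_ineq)
    also have "\<dots> \<le> e * norm v + e * norm w"
      using that by (intro add_mono mult_right_mono) auto
    also have "\<dots> < e * (norm v + norm w + 1)" using e by (simp add: algebra_simps)
    also have "\<dots> = r" unfolding e_def using nn by (metis less_numeral_extra(3) nonzero_eq_divide_eq)
    finally have "x + (s *\<^sub>R v + t *\<^sub>R w) \<in> ball x r"
      using norm_minus_cancel[of "s *\<^sub>R v + t *\<^sub>R w"] by (simp add: dist_norm)
    then show ?thesis using r(2) by (auto simp: add.assoc)
  qed
  have cont: "continuous_on ({-e..e} \<times> {-e..e}) (\<lambda>(s,t). h (x + s *\<^sub>R v + t *\<^sub>R w))"
    if "smooth_on S h" for h :: "'a \<Rightarrow> 'b"
    unfolding split_def
    by (rule continuous_on_compose2[OF smooth_on_imp_continuous_on[OF that]])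
      (auto intro!: continuous_intros inS simp: abs_le_iff)
  let ?Fw = "\<lambda>s t. dderiv w f (x + s *\<^sub>R v + t *\<^sub>R w)"
  let ?Fvw = "\<lambda>s t. dderiv v (dderiv w f) (x + s *\<^sub>R v + t *\<^sub>R w)"
  have cw: "continuous_on {0..t} (?Fw s)" "continuous_on {0..t} (?Fvw s)" if "\<bar>s\<bar> \<le> e" "t \<le> e" for s t
  proof -
    have *: "continuous_on {0..t} (\<lambda>t. h (x + s *\<^sub>R v + t *\<^sub>R w))" if h: "smooth_on S h" for h :: "'a \<Rightarrow> 'b"
      by (rule continuous_on_compose2[OF smooth_on_imp_continuous_on[OF h]])
        (use \<open>\<bar>s\<bar> \<le> e\<close> \<open>t \<le> e\<close> in \<open>auto intro!: continuous_intros inS simp: abs_le_iff\<close>)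
    show "continuous_on {0..t} (?Fw s)" "continuous_on {0..t} (?Fvw s)"
      using * smooth_on_dderiv assms(2) by blast+
  qed
  have ftc: "f (x + s *\<^sub>R v + t *\<^sub>R w) - f (x + s *\<^sub>R v) = integral {0..t} (?Fw s)"
    if "\<bar>s\<bar> \<le> e" "0 \<le> t" "t \<le> e" for s t
  proof -
    have "(?Fw s has_integral (f (x + s *\<^sub>R v + t *\<^sub>R w) - f (x + s *\<^sub>R v + 0 *\<^sub>R w))) {0..t}"
      by (rule fundamental_theorem_of_calculus[OF that(2)],
          rule has_vector_derivative_at_within, rule smooth_on_has_vector_derivative_line[OF assms(2)])
        (use that in \<open>auto intro!: inS\<close>)
    then show ?thesis by (simp add: integral_unique)
  qed
  have key: "dderiv v f (x + t *\<^sub>R w) - dderiv v f x = integral {0..t} (?Fvw 0)"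
    if t: "0 \<le> t" "t \<le> e" for t
  proof -
    have "((\<lambda>s. integral (cbox 0 t) (?Fw s)) has_vector_derivative integral (cbox 0 t) (?Fvw 0))
            (at 0 within {-e<..<e})"
    proof (rule leibniz_rule_vector_derivative)
      fix s \<tau> assume s: "s \<in> {-e<..<e}" and \<tau>: "\<tau> \<in> cbox 0 t"
      have "((\<lambda>s. dderiv w f ((x + \<tau> *\<^sub>R w) + s *\<^sub>R v)) has_vector_derivative
             dderiv v (dderiv w f) ((x + \<tau> *\<^sub>R w) + s *\<^sub>R v)) (at s)"
        by (rule smooth_on_has_vector_derivative_line[OF smooth_on_dderiv[OF assms(2)]])
          (use s \<tau> t inS[of s \<tau>] in \<open>auto simp: add_ac\<close>)
      then show "((\<lambda>s. ?Fw s \<tau>) has_vector_derivative ?Fvw s \<tau>) (at s within {-e<..<e})"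
        by (simp add: add_ac has_vector_derivative_at_within)
    next
      show "?Fw s integrable_on cbox 0 t" if "s \<in> {-e<..<e}" for s
        using cw(1)[of s t] that t by (auto intro!: integrable_continuous_interval)
      have "smooth_on S (dderiv v (dderiv w f))" using assms(2) smooth_on_dderiv by blast
      then show "continuous_on ({-e<..<e} \<times> cbox 0 t) (\<lambda>(s, t). ?Fvw s t)"
        by (rule continuous_on_subset[OF cont]) (use t in auto)
    qed (use e in auto)
    then have "((\<lambda>s. integral {0..t} (?Fw s)) has_vector_derivative integral {0..t} (?Fvw 0)) (at 0)"
      using e by (simp add: at_within_open[of 0 "{-e<..<e}"])
    then have 1: "((\<lambda>s. f (x + s *\<^sub>R v + t *\<^sub>R w) - f (x + s *\<^sub>R v)) has_vector_derivative integral {0..t} (?Fvw 0)) (at 0)"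
      by (rule has_vector_derivative_transform_within_open[where S = "{-e<..<e}"]) (use e ftc t in auto)
    have 2: "((\<lambda>s. f ((x + t *\<^sub>R w) + s *\<^sub>R v)) has_vector_derivative dderiv v f ((x + t *\<^sub>R w) + 0 *\<^sub>R v)) (at 0)"
      by (rule smooth_on_has_vector_derivative_line[OF assms(2)]) (use inS[of 0 t] t e in auto)
    have 3: "((\<lambda>s. f (x + s *\<^sub>R v)) has_vector_derivative dderiv v f (x + 0 *\<^sub>R v)) (at 0)"
      by (rule smooth_on_has_vector_derivative_line[OF assms(2)]) (use assms in auto)
    have "((\<lambda>s. f (x + s *\<^sub>R v + t *\<^sub>R w) - f (x + s *\<^sub>R v)) has_vector_derivative
        dderiv v f (x + t *\<^sub>R w) - dderiv v f x) (at 0)"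
      using has_vector_derivative_diff[OF 2 3] by (simp add: add.assoc add.commute[of "t *\<^sub>R w"])
    then show ?thesis by (rule vector_derivative_unique_at[OF _ 1])
  qed
  \<comment> \<open>The formula \<open>key\<close> holds for \<open>t\<close> \<ge> 0 only, so the
    derivative at 0 is taken within \<open>{0..e}\<close>, where it is still unique.\<close>
  have "((\<lambda>t. integral {0..t} (?Fvw 0)) has_vector_derivative ?Fvw 0 0) (at 0 within {0..e})"
    by (rule integral_has_vector_derivative[OF cw(2)]) (use e in auto)
  then have "((\<lambda>t. dderiv v f (x + t *\<^sub>R w) - dderiv v f x) has_vector_derivative ?Fvw 0 0) (at 0 within {0..e})"
    by (rule has_vector_derivative_transform[rotated 2]) (use key e in auto)
  then have "((\<lambda>t. (dderiv v f (x + t *\<^sub>R w) - dderiv v f x) + dderiv v f x) has_vector_derivative ?Fvw 0 0 + 0)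
      (at 0 within {0..e})"
    by (intro has_vector_derivative_add has_vector_derivative_const)
  then have "((\<lambda>t. dderiv v f (x + t *\<^sub>R w)) has_vector_derivative dderiv v (dderiv w f) x) (at 0 within cbox 0 e)"
    by simp
  moreover have "((\<lambda>t. dderiv v f (x + t *\<^sub>R w)) has_vector_derivative dderiv w (dderiv v f) (x + 0 *\<^sub>R w))
      (at 0 within cbox 0 e)"
    by (rule has_vector_derivative_at_within, rule smooth_on_has_vector_derivative_line[OF smooth_on_dderiv[OF assms(2)]])
      (use assms in auto)
  then have "((\<lambda>t. dderiv v f (x + t *\<^sub>R w)) has_vector_derivative dderiv w (dderiv v f) x) (at 0 within cbox 0 e)"
    by simp
  ultimately show ?thesis
    by (rule vector_derivative_unique_within_closed_interval[rotated 2]) (use e in auto)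
qed

section \<open>Integrals depending smoothly on a parameter\<close>

lemma has_derivative_integral_param:
  fixes F :: "'e::euclidean_space \<times> real \<Rightarrow> real"
  assumes "open U" "smooth_on (U \<times> UNIV) F" "p \<in> U"
  shows "((\<lambda>p. integral {a..b} (\<lambda>x. F (p, x))) has_derivative
          (\<lambda>v. integral {a..b} (\<lambda>x. dderiv (v, 0) F (p, x)))) (at p)"
proof -
  let ?S = "U \<times> (UNIV :: real set)"
  obtain r where r: "r > 0" "ball p r \<subseteq> U" using assms(1,3) open_contains_ball by blast
  have der: "((\<lambda>q. F (q, x)) has_derivative (\<lambda>v. dderiv (v, 0) F (q, x))) (at q)" if "q \<in> U" for q x
  proof -
    have "(F has_derivative (\<lambda>v. dderiv v F (q,x))) (at (q,x))"
      using smooth_on_has_derivative[OF assms(2)] that by blast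
    then show ?thesis
      by (rule has_derivative_compose[rotated, where f = "\<lambda>q. (q,x)"]) (auto intro!: derivative_eq_intros)
  qed
  \<comment> \<open>The Leibniz rule takes the derivative in the parameter as a bounded linear map
    varying continuously. As the parameter space is finite-dimensional, this continuity can be
    checked on each basis vector, where it is the continuity of one directional derivative.\<close>
  define fx where "fx = (\<lambda>q x. Blinfun (\<lambda>v. dderiv (v, 0) F (q, x)))"
  have fx: "blinfun_apply (fx q x) = (\<lambda>v. dderiv (v, 0) F (q, x))" if "q \<in> U" for q x
    unfolding fx_def using has_derivative_bounded_linear[OF der[OF that]] by (rule bounded_linear_Blinfun_apply)
  have cF: "continuous_on {a..b} (\<lambda>x. H (q, x))" if "smooth_on ?S H" "q \<in> U" for H :: "'e \<times> real \<Rightarrow> real" and q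
    by (rule continuous_on_compose2[OF smooth_on_imp_continuous_on[OF that(1)]])
      (use that in \<open>auto intro!: continuous_intros\<close>)
  have cfx: "continuous_on (U \<times> cbox a b) (\<lambda>(q, x). fx q x)"
  proof (rule continuous_on_blinfun_componentwise)
    fix i :: 'e
    have "continuous_on (U \<times> cbox a b) (dderiv (i, 0) F)"
      using smooth_on_imp_continuous_on[OF smooth_on_dderiv[OF assms(2)]] continuous_on_subset by blast
    moreover have "blinfun_apply (case z of (q, x) \<Rightarrow> fx q x) i = dderiv (i, 0) F z" if "z \<in> U \<times> cbox a b" for z
      using fx that by auto
    ultimately show "continuous_on (U \<times> cbox a b) (\<lambda>z. blinfun_apply (case z of (q, x) \<Rightarrow> fx q x) i)"
      by (simp cong: continuous_on_cong)
  qed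
  have 1: "((\<lambda>q. integral (cbox a b) (\<lambda>x. F (q, x))) has_derivative blinfun_apply (integral (cbox a b) (fx p)))
      (at p within ball p r)"
  proof (rule leibniz_rule)
    show "((\<lambda>q. F (q, x)) has_derivative blinfun_apply (fx q x)) (at q within ball p r)" if "q \<in> ball p r" for q x
    proof -
      have "q \<in> U" using that r by blast
      then show ?thesis using der fx has_derivative_at_withinI by metis
    qed
    show "(\<lambda>x. F (q, x)) integrable_on cbox a b" if "q \<in> ball p r" for q
      using cF[OF assms(2)] that r by (auto intro!: integrable_continuous_interval)
    show "continuous_on (ball p r \<times> cbox a b) (\<lambda>(q, x). fx q x)"
      by (rule continuous_on_subset[OF cfx]) (use r in auto)
  qed (use r in auto)
  have 2: "blinfun_apply (integral (cbox a b) (fx p)) = (\<lambda>v. integral (cbox a b) (\<lambda>x. dderiv (v, 0) F (p, x)))"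
  proof
    fix v
    have "continuous_on (cbox a b) (fx p)"
      using continuous_on_compose2[OF cfx, of "cbox a b" "\<lambda>x. (p, x)"] assms(3)
      by (force intro!: continuous_intros)
    then have "fx p integrable_on cbox a b" by (rule integrable_continuous)
    then show "blinfun_apply (integral (cbox a b) (fx p)) v = integral (cbox a b) (\<lambda>x. dderiv (v, 0) F (p, x))"
      using blinfun_apply_integral[of "fx p" "cbox a b" v] fx[OF assms(3)] by simp
  qed
  have "at p within ball p r = at p" using r(1) by (simp add: at_within_open[of p "ball p r"])
  then show ?thesis using 1 unfolding 2 by simp
qed

text \<open>A directional derivative of the integral is the integral of
  \<open>dderiv (v, 0) F\<close>, again a smooth integrand; hence an induction on the order with
  \<open>F\<close> arbitrary.\<close>

lemma smooth_on_integral_param: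
  fixes F :: "'e::euclidean_space \<times> real \<Rightarrow> real"
  assumes "open U" "smooth_on (U \<times> UNIV) F"
  shows "smooth_on U (\<lambda>p. integral {a..b} (\<lambda>x. F (p, x)))"
proof -
  have "k_smooth_on k U (\<lambda>p. integral {a..b} (\<lambda>x. F (p, x)))" for k
    using assms(2)
  proof (induction k arbitrary: F)
    case 0
    show ?case
      unfolding k_smooth_on.simps
      by (rule continuous_at_imp_continuous_on)
        (use has_derivative_continuous[OF has_derivative_integral_param[OF assms(1) 0]] in blast)
  next
    case (Suc k)
    note D = has_derivative_integral_param[OF assms(1) Suc.prems, of _ a b]
    have "k_smooth_on k U (\<lambda>p. integral {a..b} (\<lambda>x. dderiv (v, 0) F (p, x)))" for v
      by (rule Suc.IH[OF smooth_on_dderiv[OF Suc.prems]])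
    then have "k_smooth_on k U (dderiv v (\<lambda>p. integral {a..b} (\<lambda>x. F (p, x))))" for v
      by (rule k_smooth_on_cong[OF assms(1), rotated]) (simp add: dderiv_eq[OF D])
    then show ?case unfolding k_smooth_on_Suc using D unfolding differentiable_def by blast
  qed
  then show ?thesis unfolding smooth_on_def by blast
qed

section \<open>Matrices\<close>

lemma pos_less_iff: "pos i < pos j \<longleftrightarrow> i < (j::'n::{finite,linorder})"
proof -
  have "pos i < pos j" if "i < j" for i j :: 'n
    unfolding pos_def by (rule psubset_card_mono) (use that in auto)
  then show ?thesis by (metis less_asym' linorder_neqE)
qed

lemma pos_inject: "pos i = pos j \<longleftrightarrow> i = (j::'n::{finite,linorder})"
  by (metis less_irrefl linorder_neqE pos_less_iff)

lemma pos_less_card: "pos (i::'n::{finite,linorder}) < CARD('n)"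
  unfolding pos_def by (rule psubset_card_mono) auto

text \<open>Injectivity and the bound make \<open>pos\<close> a bijection onto an initial segment of
  the naturals, by counting. This is how an index is obtained from an order of
  differentiation.\<close>

lemma ex_pos: "k < CARD('n::{finite,linorder}) \<Longrightarrow> \<exists>i::'n. pos i = k"
proof -
  assume k: "k < CARD('n)"
  have "card (range (pos :: 'n \<Rightarrow> nat)) = CARD('n)"
    by (rule card_image) (auto simp: inj_def pos_inject)
  then have "range (pos :: 'n \<Rightarrow> nat) = {..<CARD('n)}"
    by (intro card_subset_eq) (auto simp: pos_less_card)
  then have "k \<in> range (pos :: 'n \<Rightarrow> nat)" using k by blast
  then show ?thesis by blast
qed

lemma Suc_pos_Max: "Suc (pos (Max UNIV :: 'n::{finite,linorder})) = CARD('n)"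
proof -
  have "CARD('n) - 1 < CARD('n)" by simp
  then obtain i :: 'n where i: "pos i = CARD('n) - 1" using ex_pos by metis
  have "i \<le> Max UNIV" by simp
  then have "pos i \<le> pos (Max UNIV :: 'n)" by (metis not_le pos_less_iff)
  then show ?thesis using i pos_less_card[of "Max UNIV :: 'n"] by linarith
qed

lemma bounded_bilinear_matrix_mult:
  "bounded_bilinear ((**) :: real^'n^'n \<Rightarrow> real^'n^'n \<Rightarrow> real^'n^'n)"
proof -
  have "bilinear ((**) :: real^'n^'n \<Rightarrow> real^'n^'n \<Rightarrow> real^'n^'n)"
    unfolding bilinear_def
    by (auto intro!: linearI simp: vec_eq_iff matrix_matrix_mult_def algebra_simps sum.distrib sum_distrib_left)
  then show ?thesis by (simp add: bilinear_conv_bounded_bilinear)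
qed

lemmas matrix_mult_bilinear_simps =
  bounded_bilinear.add_left[OF bounded_bilinear_matrix_mult]
  bounded_bilinear.add_right[OF bounded_bilinear_matrix_mult]
  bounded_bilinear.diff_left[OF bounded_bilinear_matrix_mult]
  bounded_bilinear.diff_right[OF bounded_bilinear_matrix_mult]
  bounded_bilinear.minus_left[OF bounded_bilinear_matrix_mult]
  bounded_bilinear.minus_right[OF bounded_bilinear_matrix_mult]
  bounded_bilinear.scaleR_left[OF bounded_bilinear_matrix_mult]
  bounded_bilinear.scaleR_right[OF bounded_bilinear_matrix_mult]
  bounded_bilinear.zero_left[OF bounded_bilinear_matrix_mult]
  bounded_bilinear.zero_right[OF bounded_bilinear_matrix_mult]

section \<open>Trace, inverse and determinant\<close>

lemma bounded_linear_trace: "bounded_linear (trace :: real^'n^'n \<Rightarrow> real)"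
  unfolding linear_conv_bounded_linear[symmetric]
  by (auto intro!: linearI simp: trace_def sum.distrib sum_distrib_left)

lemmas trace_linear_simps =
  linear_simps(1,2,3,4,5)[OF bounded_linear_trace]

lemma matrix_inv_mult:
  fixes A :: "real^'n^'n"
  assumes "det A \<noteq> 0"
  shows "matrix_inv A ** A = mat 1" "A ** matrix_inv A = mat 1"
proof -
  have "\<exists>B. A ** B = mat 1 \<and> B ** A = mat 1"
    using assms invertible_det_nz[of A] unfolding invertible_def by blast
  from someI_ex[OF this] show "matrix_inv A ** A = mat 1" "A ** matrix_inv A = mat 1"
    unfolding matrix_inv_def by auto
qed

lemma matrix_inv_unique:
  fixes A B :: "real^'n^'n"
  assumes "A ** B = mat 1"
  shows "matrix_inv A = B"
proof -
  have "det A \<noteq> 0" using assms by (metis det_I det_mul mult_zero_left zero_neq_one)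
  then have "matrix_inv A ** (A ** B) = B"
    by (simp add: matrix_mul_assoc matrix_inv_mult)
  then show ?thesis using assms by simp
qed

text \<open>In the Leibniz formula a permutation other than \<open>id\<close> moves at least two
  points. Each product with one factor left out then still contains an off-diagonal entry of the
  identity, which is 0; only \<open>id\<close> contributes, and it gives the trace.\<close>

lemma det_has_derivative_mat1:
  "((det :: real^'n^'n \<Rightarrow> real) has_derivative trace) (at (mat 1))"
proof -
  let ?P = "{p. p permutes (UNIV::'n set)}"
  let ?I = "mat 1 :: real^'n^'n"
  have "((\<lambda>A::real^'n^'n. \<Sum>p\<in>?P. of_int (sign p) * (\<Prod>i\<in>UNIV. A $ i $ p i)) has_derivative
     (\<lambda>H. \<Sum>p\<in>?P. of_int (sign p) * (\<Sum>i\<in>UNIV. H $ i $ p i * (\<Prod>j\<in>UNIV - {i}. ?I $ j $ p j)))) (at ?I)"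
    by (intro has_derivative_sum has_derivative_mult_right has_derivative_prod
        bounded_linear.has_derivative[OF bounded_linear_vec_nth] has_derivative_ident)
  moreover have "(\<lambda>H. \<Sum>p\<in>?P. of_int (sign p) * (\<Sum>i\<in>UNIV. H $ i $ p i * (\<Prod>j\<in>UNIV - {i}. ?I $ j $ p j))) = trace"
  proof
    fix H :: "real^'n^'n"
    have 0: "(\<Prod>j\<in>UNIV - {i}. ?I $ j $ p j) = 0" if p: "p permutes UNIV" "p \<noteq> id" for p :: "'n \<Rightarrow> 'n" and i
    proof -
      obtain a where a: "p a \<noteq> a" using p(2) by (metis ext id_apply)
      have "p (p a) \<noteq> p a" using a p(1) by (metis permutes_inj injD)
      then obtain j where "j \<noteq> i" "p j \<noteq> j" using a by metis
      then show ?thesis by (intro prod_zero) (auto simp: mat_def intro!: bexI[of _ j])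
    qed
    have "(\<Sum>p\<in>?P. of_int (sign p) * (\<Sum>i\<in>UNIV. H $ i $ p i * (\<Prod>j\<in>UNIV - {i}. ?I $ j $ p j)))
       = (\<Sum>p\<in>{id}. of_int (sign p) * (\<Sum>i\<in>UNIV. H $ i $ p i * (\<Prod>j\<in>UNIV - {i}. ?I $ j $ p j)))"
      by (rule sum.mono_neutral_right) (auto simp: permutes_id 0)
    also have "\<dots> = trace H" by (simp add: trace_def mat_def)
    finally show "(\<Sum>p\<in>?P. of_int (sign p) * (\<Sum>i\<in>UNIV. H $ i $ p i * (\<Prod>j\<in>UNIV - {i}. ?I $ j $ p j)))
      = trace H" .
  qed
  ultimately show ?thesis unfolding det_def[abs_def] by simp
qed

text \<open>Jacobi's formula, reduced to the derivative at the identity: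
  \<open>det (g y) = det (g x) * det (g(x)^-1 g(y))\<close>, and the last matrix is
  \<open>mat 1\<close> at \<open>y = x\<close>.\<close>

lemma has_real_derivative_det:
  fixes g :: "real \<Rightarrow> real^'n^'n"
  assumes "(g has_vector_derivative g') (at x)" "det (g x) \<noteq> 0"
  shows "((\<lambda>x. det (g x)) has_real_derivative det (g x) * trace (matrix_inv (g x) ** g')) (at x)"
proof -
  let ?h = "\<lambda>y. matrix_inv (g x) ** g y"
  have h: "(?h has_vector_derivative matrix_inv (g x) ** g') (at x)"
    by (rule bounded_linear.has_vector_derivative[OF
          bounded_bilinear.bounded_linear_right[OF bounded_bilinear_matrix_mult] assms(1)])
  have "((\<lambda>y. det (?h y)) has_derivative (\<lambda>t. trace (t *\<^sub>R (matrix_inv (g x) ** g')))) (at x)"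
    by (rule has_derivative_compose[OF h[unfolded has_vector_derivative_def]])
      (simp add: matrix_inv_mult[OF assms(2)] det_has_derivative_mat1)
  then have "((\<lambda>y. det (?h y)) has_real_derivative trace (matrix_inv (g x) ** g')) (at x)"
    by (simp add: has_field_derivative_def trace_linear_simps mult_commute_abs)
  then have "((\<lambda>y. det (g x) * det (?h y)) has_real_derivative det (g x) * trace (matrix_inv (g x) ** g')) (at x)"
    by (rule DERIV_cmult)
  moreover have "det (g x) * det (?h y) = det (g y)" for y
  proof -
    have "det (g x) * det (?h y) = det (g x ** matrix_inv (g x) ** g y)"
      by (simp add: det_mul mult.assoc)
    then show ?thesis by (simp add: matrix_inv_mult[OF assms(2)])
  qed
  ultimately show ?thesis by simp
qed

lemma smooth_on_matrixI:
  fixes f :: "'a::real_normed_vector \<Rightarrow> real^'n^'m"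
  assumes "open S" "\<And>i j. smooth_on S (\<lambda>x. f x $ i $ j)"
  shows "smooth_on S f"
proof -
  have "smooth_on S (\<lambda>x. \<chi> i j. f x $ i $ j)"
    by (rule smooth_on_vec_lambda[OF assms(1)], rule smooth_on_vec_lambda[OF assms])
  then show ?thesis by (simp add: vec_lambda_eta)
qed

lemma smooth_on_det:
  fixes g :: "'a::real_normed_vector \<Rightarrow> real^'n^'n"
  assumes "open S" "\<And>i j. smooth_on S (\<lambda>x. g x $ i $ j)"
  shows "smooth_on S (\<lambda>x. det (g x))"
  unfolding det_def
  by (rule smooth_on_sum[OF assms(1)], rule smooth_on_bilinear[OF assms(1) bounded_bilinear_mult],
      rule smooth_on_const, rule smooth_on_prod[OF assms(1)], rule assms(2))

text \<open>By Cramer's rule the inverse of a matrix of determinant one is polynomial in its entries.\<close>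

lemma smooth_on_matrix_inv:
  fixes g :: "'a::real_normed_vector \<Rightarrow> real^'n^'n"
  assumes "open S" "smooth_on S g" "\<And>x. x \<in> S \<Longrightarrow> det (g x) = 1"
  shows "smooth_on S (\<lambda>x. matrix_inv (g x))"
proof (rule smooth_on_matrixI[OF assms(1)])
  fix k l :: 'n
  \<comment> \<open>Column \<open>k\<close> is replaced by the unit vector \<open>e_l\<close>: the
    solution of \<open>g y = e_l\<close> is column \<open>l\<close> of the inverse, and its
    coordinate \<open>k\<close> is the entry sought.\<close>
  let ?C = "\<lambda>x. (\<chi> i j. if j = k then axis l 1 $ i else g x $ i $ j) :: real^'n^'n"
  have sg: "smooth_on S (\<lambda>x. g x $ i $ j)" for i j
    using smooth_on_vec_nth[OF assms(1) smooth_on_vec_nth[OF assms(1,2)]] .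
  have sC: "smooth_on S (\<lambda>x. det (?C x))"
  proof (rule smooth_on_det[OF assms(1)])
    show "smooth_on S (\<lambda>x. ?C x $ i $ j)" for i j
      by (cases "j = k") (simp_all add: sg smooth_on_const)
  qed
  have eq: "det (?C x) = matrix_inv (g x) $ k $ l" if "x \<in> S" for x
  proof -
    have d: "det (g x) \<noteq> 0" using assms(3)[OF that] by simp
    have "g x *v (matrix_inv (g x) *v axis l 1) = axis l 1"
      by (simp add: matrix_vector_mul_assoc matrix_inv_mult[OF d])
    then have "matrix_inv (g x) *v axis l 1 =
        (\<chi> k. det (\<chi> i j. if j = k then axis l 1 $ i else g x $ i $ j) / det (g x))"
      using cramer[OF d] by blast
    then have "(matrix_inv (g x) *v axis l 1) $ k = det (?C x)"
      by (simp add: assms(3)[OF that])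
    then show ?thesis by (simp add: matrix_vector_mult_basis column_def)
  qed
  show "smooth_on S (\<lambda>x. matrix_inv (g x) $ k $ l)"
    by (rule smooth_on_cong[OF assms(1) eq sC])
qed

text \<open>Differentiate the constant product \<open>g^-1 g = 1\<close> and multiply by
  \<open>g^-1\<close> on the right.\<close>

lemma dderiv_matrix_inv:
  fixes g :: "'a::real_normed_vector \<Rightarrow> real^'n^'n"
  assumes "open S" "smooth_on S g" "\<And>x. x \<in> S \<Longrightarrow> det (g x) = 1" "x \<in> S"
  shows "dderiv v (\<lambda>x. matrix_inv (g x)) x = - (matrix_inv (g x) ** dderiv v g x ** matrix_inv (g x))"
proof -
  let ?N = "\<lambda>x. matrix_inv (g x)"
  have d: "det (g y) \<noteq> 0" if "y \<in> S" for y using assms(3)[OF that] by simp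
  have sN: "smooth_on S ?N" by (rule smooth_on_matrix_inv[OF assms(1,2,3)])
  have s1: "smooth_on S (\<lambda>x. ?N x ** g x)"
    by (rule smooth_on_bilinear[OF assms(1) bounded_bilinear_matrix_mult sN assms(2)])
  have "dderiv v (\<lambda>x. ?N x ** g x) x = dderiv v (\<lambda>x. mat 1 :: real^'n^'n) x"
    by (rule dderiv_cong_open[OF assms(1,4)])
      (use s1 assms(4) d in \<open>auto simp: matrix_inv_mult intro: smooth_on_imp_differentiable\<close>)
  then have "?N x ** dderiv v g x + dderiv v ?N x ** g x = 0"
    unfolding smooth_on_dderiv_bilinear[OF bounded_bilinear_matrix_mult sN assms(2,4)]
    by (simp add: dderiv_def)
  then have "(?N x ** dderiv v g x + dderiv v ?N x ** g x) ** ?N x = 0"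
    by (simp add: matrix_mult_bilinear_simps)
  then have "?N x ** dderiv v g x ** ?N x + dderiv v ?N x ** (g x ** ?N x) = 0"
    by (simp add: matrix_mult_bilinear_simps matrix_mul_assoc)
  then show ?thesis using d[OF assms(4)] by (simp add: matrix_inv_mult add_eq_0_iff)
qed

section \<open>Central affine curves\<close>

lemma nth_vderiv_0 [simp]: "nth_vderiv 0 f = f"
  by (simp add: nth_vderiv_def)

lemma nth_vderiv_Suc: "nth_vderiv (Suc k) f = (\<lambda>x. vector_derivative (nth_vderiv k f) (at x))"
  by (simp add: nth_vderiv_def)

text \<open>Formulas for iterated derivatives are proved by proposing the whole sequence
  \<open>F\<close> and checking a single differentiation.\<close>

lemma nth_vderiv_unique:
  assumes "F 0 = f" "\<And>k x. (F k has_vector_derivative F (Suc k) x) (at x)"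
  shows "nth_vderiv k f = F k"
proof (induction k)
  case (Suc k)
  then show ?case by (simp add: nth_vderiv_Suc vector_derivative_at[OF assms(2)])
qed (simp add: assms(1))

lemma smooth_has_vector_derivative:
  assumes "smooth_on UNIV f"
  shows "(f has_vector_derivative dderiv 1 f x) (at x)"
  using smooth_on_has_vector_derivative_line[OF assms, of 0 x 1] by simp

lemma smooth_nth_vderiv:
  assumes "smooth_on UNIV f"
  shows "smooth_on UNIV (nth_vderiv k f)"
proof (induction k)
  case (Suc k)
  have "nth_vderiv (Suc k) f = dderiv 1 (nth_vderiv k f)"
    unfolding nth_vderiv_Suc using vector_derivative_at[OF smooth_has_vector_derivative[OF Suc]] by (rule ext)
  then show ?case using smooth_on_dderiv[OF Suc] by simp
qed (simp add: assms)

lemma nth_vderiv_has_vector_derivative: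
  assumes "smooth_on UNIV f"
  shows "(nth_vderiv k f has_vector_derivative nth_vderiv (Suc k) f x) (at x)"
  using smooth_has_vector_derivative[OF smooth_nth_vderiv[OF assms], of k x]
  unfolding nth_vderiv_Suc by (metis vector_derivative_at)

lemma nth_vderiv_compose:
  assumes "smooth_on UNIV f"
  shows "nth_vderiv k (nth_vderiv m f) = nth_vderiv (k + m) f"
  by (rule nth_vderiv_unique[of "\<lambda>k. nth_vderiv (k + m) f"])
    (use nth_vderiv_has_vector_derivative[OF assms] in auto)

lemma nth_vderiv_linear:
  assumes "smooth_on UNIV f" "bounded_linear L"
  shows "nth_vderiv k (\<lambda>x. L (f x)) = (\<lambda>x. L (nth_vderiv k f x))"
  by (rule nth_vderiv_unique[of "\<lambda>k x. L (nth_vderiv k f x)"])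
    (use bounded_linear.has_vector_derivative[OF assms(2) nth_vderiv_has_vector_derivative[OF assms(1)]] in auto)

lemma nth_vderiv_lincomb:
  assumes "smooth_on UNIV f" "smooth_on UNIV h"
  shows "nth_vderiv k (\<lambda>x. c *\<^sub>R f x + d *\<^sub>R h x) = (\<lambda>x. c *\<^sub>R nth_vderiv k f x + d *\<^sub>R nth_vderiv k h x)"
proof (rule nth_vderiv_unique[of "\<lambda>k x. c *\<^sub>R nth_vderiv k f x + d *\<^sub>R nth_vderiv k h x"])
  have s: "((\<lambda>x. c *\<^sub>R f x) has_vector_derivative c *\<^sub>R f') (at x)"
    if "(f has_vector_derivative f') (at x)" for c f f' and x :: real
    using bounded_linear.has_vector_derivative[OF bounded_linear_scaleR_right that] .
  fix k x
  show "((\<lambda>x. c *\<^sub>R nth_vderiv k f x + d *\<^sub>R nth_vderiv k h x) has_vector_derivative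
         c *\<^sub>R nth_vderiv (Suc k) f x + d *\<^sub>R nth_vderiv (Suc k) h x) (at x)"
    by (rule has_vector_derivative_add[OF s[OF nth_vderiv_has_vector_derivative[OF assms(1)]]
          s[OF nth_vderiv_has_vector_derivative[OF assms(2)]]])
qed simp

lemma nth_vderiv_periodic:
  assumes "smooth_on UNIV f" "\<And>x. f (x + T) = f x"
  shows "nth_vderiv k f (x + T) = nth_vderiv k f x"
proof -
  have "nth_vderiv k f = (\<lambda>x. nth_vderiv k f (x + T))"
  proof (rule nth_vderiv_unique[of "\<lambda>k x. nth_vderiv k f (x + T)"])
    fix k x
    have "(nth_vderiv k f \<circ> (\<lambda>x. x + T) has_vector_derivative 1 *\<^sub>R nth_vderiv (Suc k) f (x + T)) (at x)"
      by (rule vector_diff_chain_at[OF _ nth_vderiv_has_vector_derivative[OF assms(1)]])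
        (auto intro!: derivative_eq_intros)
    then show "((\<lambda>x. nth_vderiv k f (x + T)) has_vector_derivative nth_vderiv (Suc k) f (x + T)) (at x)"
      by (simp add: o_def)
  qed (simp add: assms(2))
  then show ?thesis by metis
qed

section \<open>Matrices assembled from columns, and the frame\<close>

lemma bounded_linear_matrix_column:
  "bounded_linear (\<lambda>y::real^'n. \<chi> i j. if j = k then y $ i else (0::real))"
  unfolding linear_conv_bounded_linear[symmetric] by (rule linearI) (auto simp: vec_eq_iff)

text \<open>Each summand is a bounded linear image of one column, so smoothness and derivatives of a
  matrix reduce to those of its columns.\<close>

lemma matrix_of_columns_eq_sum:
  fixes c :: "'n::finite \<Rightarrow> real^'m::finite"
  shows "(\<chi> i j. c j $ i) = (\<Sum>k\<in>UNIV. \<chi> i j. if j = k then c k $ i else (0::real))"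
  by (simp add: vec_eq_iff)

lemma smooth_on_matrix_of_columns:
  fixes c :: "'n::finite \<Rightarrow> 'a::real_normed_vector \<Rightarrow> real^'m::finite"
  assumes "open S" "\<And>j. smooth_on S (c j)"
  shows "smooth_on S (\<lambda>x. \<chi> i j. c j x $ i)"
  unfolding matrix_of_columns_eq_sum
  by (rule smooth_on_sum[OF assms(1)], rule smooth_on_linear[OF assms(1) bounded_linear_matrix_column assms(2)])

lemma has_derivative_matrix_of_columns:
  fixes c :: "'n::finite \<Rightarrow> 'a::real_normed_vector \<Rightarrow> real^'m::finite"
  assumes "\<And>j. (c j has_derivative c' j) F"
  shows "((\<lambda>x. \<chi> i j. c j x $ i) has_derivative (\<lambda>h. \<chi> i j. c' j h $ i)) F"
  unfolding matrix_of_columns_eq_sum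
  by (rule has_derivative_sum, rule bounded_linear.has_derivative[OF bounded_linear_matrix_column assms])

lemma smooth_frame: "smooth_on UNIV v \<Longrightarrow> smooth_on UNIV (frame v)"
  unfolding frame_def[abs_def]
  by (rule smooth_on_matrix_of_columns[OF open_UNIV smooth_nth_vderiv])

lemma frame_has_vector_derivative:
  fixes v :: "'n::{finite,linorder} curve"
  assumes "smooth_on UNIV v"
  shows "(frame v has_vector_derivative frame (nth_vderiv 1 v) x) (at x)"
proof -
  have D: "((\<lambda>x. \<chi> i (j::'n). nth_vderiv (pos j) v x $ i) has_derivative
     (\<lambda>h. \<chi> i (j::'n). (h *\<^sub>R nth_vderiv (Suc (pos j)) v x) $ i)) (at x)"
    by (rule has_derivative_matrix_of_columns)
      (rule nth_vderiv_has_vector_derivative[OF assms, unfolded has_vector_derivative_def])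
  have eq1: "(\<lambda>h. \<chi> i j. (h *\<^sub>R nth_vderiv (Suc (pos j)) v x) $ i) = (\<lambda>h. h *\<^sub>R frame (nth_vderiv 1 v) x)"
    unfolding frame_def nth_vderiv_compose[OF assms] by (simp add: vec_eq_iff fun_eq_iff)
  have eq2: "(\<lambda>x. \<chi> i j. nth_vderiv (pos j) v x $ i) = frame v"
    by (rule ext) (simp add: frame_def)
  show ?thesis unfolding has_vector_derivative_def using D unfolding eq1 eq2 .
qed

lemma frame_periodic:
  "smooth_on UNIV v \<Longrightarrow> (\<And>x. v (x + T) = v x) \<Longrightarrow> frame v (x + T) = frame v x"
  by (simp add: frame_def nth_vderiv_periodic)

lemma frame_lincomb:
  assumes "smooth_on UNIV v" "smooth_on UNIV w"
  shows "frame (\<lambda>x. c *\<^sub>R v x + d *\<^sub>R w x) x = c *\<^sub>R frame v x + d *\<^sub>R frame w x"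
  by (simp add: frame_def nth_vderiv_lincomb[OF assms] vec_eq_iff)

lemma frame_matrix_vector_mult:
  assumes "smooth_on UNIV v"
  shows "frame (\<lambda>x. c *v v x) x = c ** frame v x"
  unfolding frame_def nth_vderiv_linear[OF assms matrix_vector_mul_bounded_linear]
  by (simp add: vec_eq_iff matrix_vector_mult_def matrix_matrix_mult_def)

lemma smooth_vderiv: "smooth_on UNIV v \<Longrightarrow> smooth_on UNIV (nth_vderiv 1 v)"
  by (rule smooth_nth_vderiv)

lemma matrix_mult_frame_nth:
  "(A ** frame v x) $ i $ j = (A *v nth_vderiv (pos j) v x) $ i"
  by (simp add: frame_def matrix_matrix_mult_def matrix_vector_mult_def)

lemma frame_vderiv_nth:
  assumes "smooth_on UNIV v" "pos k = Suc (pos j)"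
  shows "frame (nth_vderiv 1 v) x $ i $ j = frame v x $ i $ k"
  by (simp add: frame_def nth_vderiv_compose[OF assms(1)] assms(2))

lemma ex_Suc_pos:
  assumes "(j::'n::{finite,linorder}) \<noteq> Max UNIV"
  shows "\<exists>k::'n. pos k = Suc (pos j)"
proof (rule ex_pos)
  have "j < Max UNIV" using assms by (simp add: order_less_le)
  then have "pos j < pos (Max UNIV :: 'n)" by (simp add: pos_less_iff)
  then show "Suc (pos j) < CARD('n)" using Suc_pos_Max[where 'n='n] by linarith
qed

text \<open>Multiplying by \<open>b_mat\<close> on the right shifts columns, exactly as
  differentiation shifts the columns of a frame. This is the source of the agreement outside the
  last column.\<close>

lemma matrix_mult_b_mat_nth:
  fixes A :: "'n::{finite,linorder} sq_matrix"
  assumes "pos k = Suc (pos j)"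
  shows "(A ** b_mat) $ i $ j = A $ i $ k"
proof -
  have "(A ** b_mat) $ i $ j = (\<Sum>l\<in>UNIV. A $ i $ l * (if l = k then 1 else 0))"
    unfolding matrix_matrix_mult_def b_mat_def by (simp add: assms[symmetric] pos_inject)
  also have "\<dots> = A $ i $ k" by (simp add: mult_delta_right)
  finally show ?thesis .
qed

section \<open>The structure equation along a fixed curve\<close>

locale central_affine_curve =
  fixes \<gamma> :: "'n::{finite,linorder} curve"
  assumes curve: "\<gamma> \<in> central_affine_curves"
begin

abbreviation "g \<equiv> frame \<gamma>"
definition N where "N x = matrix_inv (g x)"
definition A where "A x = b_mat + curvature \<gamma> x"

lemma smooth: "smooth_on UNIV \<gamma>" and periodic: "\<gamma> (x + 2 * pi) = \<gamma> x" and det: "det (g x) = 1"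
  using curve unfolding central_affine_curves_def smooth_loop_def by auto

lemma N_mult: "N x ** g x = mat 1" "g x ** N x = mat 1"
  unfolding N_def by (rule matrix_inv_mult, simp add: det)+

lemma N_cancel [simp]: "N x ** (g x ** B) = B" "g x ** (N x ** B) = B"
   "B ** N x ** g x = B" "B ** g x ** N x = B"
  by (simp add: matrix_mul_assoc N_mult) (simp add: matrix_mul_assoc N_mult,
     simp add: matrix_mul_assoc[symmetric] N_mult, simp add: matrix_mul_assoc[symmetric] N_mult)

lemma smooth_N: "smooth_on UNIV N"
  unfolding N_def[abs_def]
  by (rule smooth_on_matrix_inv[OF open_UNIV smooth_frame[OF smooth]]) (rule det)

lemma N_has_vector_derivative:
  "(N has_vector_derivative - (N x ** frame (nth_vderiv 1 \<gamma>) x ** N x)) (at x)"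
proof -
  have "dderiv 1 g x = frame (nth_vderiv 1 \<gamma>) x"
    using vector_derivative_at[OF smooth_has_vector_derivative[OF smooth_frame[OF smooth]]]
      vector_derivative_at[OF frame_has_vector_derivative[OF smooth]] by metis
  then have "dderiv 1 N x = - (N x ** frame (nth_vderiv 1 \<gamma>) x ** N x)"
    unfolding N_def[abs_def]
    using dderiv_matrix_inv[OF open_UNIV smooth_frame[OF smooth] det UNIV_I, of 1 x] by simp
  then show ?thesis using smooth_has_vector_derivative[OF smooth_N, of x] by simp
qed

lemma N_periodic: "N (x + 2 * pi) = N x"
  unfolding N_def using frame_periodic[OF smooth periodic] by simp

text \<open>This is \<open>g^-1 g = 1\<close> read column by column. The bound on \<open>q\<close>
  matters: from order n on, the derivatives are no longer columns of \<open>g\<close>, and the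
  curvature enters.\<close>

lemma N_mult_nth_vderiv:
  assumes "q < CARD('n)"
  shows "(N x *v nth_vderiv q \<gamma> x) $ r = (if pos r = q then 1 else 0)"
proof -
  obtain k :: 'n where k: "pos k = q" using ex_pos assms by blast
  have "(N x *v nth_vderiv q \<gamma> x) $ r = (N x ** g x) $ r $ k"
    unfolding matrix_mult_frame_nth k ..
  then show ?thesis unfolding N_mult by (auto simp: mat_def k[symmetric] pos_inject)
qed

text \<open>Outside the last column both sides are the column shift. In the last column only the
  bottom entry, which \<open>curvature\<close> sets to 0, is in question; since the other diagonal
  entries vanish it equals \<open>tr (g^-1 g_x)\<close>, and this is 0 by Jacobi's formula for the
  constant determinant.\<close>

lemma A_eq: "A x = N x ** frame (nth_vderiv 1 \<gamma>) x"
proof -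
  let ?M = "N x ** frame (nth_vderiv 1 \<gamma>) x"
  have M: "?M $ i $ j = b_mat $ i $ j" if j: "j \<noteq> Max UNIV" for i j
  proof -
    obtain k :: 'n where k: "pos k = Suc (pos j)" using ex_Suc_pos[OF j] by blast
    have "?M $ i $ j = (N x ** g x) $ i $ k"
      unfolding matrix_mult_frame_nth nth_vderiv_compose[OF smooth] k by simp
    also have "\<dots> = (mat 1 ** b_mat) $ i $ j" unfolding N_mult matrix_mult_b_mat_nth[OF k] ..
    finally show ?thesis by simp
  qed
  have "((\<lambda>x. det (g x)) has_real_derivative det (g x) * trace (matrix_inv (g x) ** frame (nth_vderiv 1 \<gamma>) x)) (at x)"
    by (rule has_real_derivative_det[OF frame_has_vector_derivative[OF smooth]]) (simp add: det)
  then have "((\<lambda>x. 1) has_real_derivative trace ?M) (at x)"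
    by (simp add: det N_def)
  then have "0 = trace ?M" using DERIV_unique[OF DERIV_const] by blast
  also have "trace ?M = (\<Sum>i\<in>{Max UNIV}. ?M $ i $ i)"
    unfolding trace_def by (rule sum.mono_neutral_right) (auto simp: M b_mat_def simp del: One_nat_def)
  finally have M0: "?M $ Max UNIV $ Max UNIV = 0" by simp
  have "A x $ i $ j = ?M $ i $ j" for i j
  proof (cases "j = Max UNIV")
    case False
    then show ?thesis unfolding A_def by (simp add: M curvature_def del: One_nat_def)
  next
    case True
    have "pos i \<noteq> Suc (pos (Max UNIV :: 'n))" using pos_less_card[of i] Suc_pos_Max[where 'n='n] by simp
    then have "(b_mat :: 'n sq_matrix) $ i $ Max UNIV = 0" by (simp add: b_mat_def)
    then show ?thesis unfolding A_def using True M0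
      by (simp add: curvature_def vector_derivative_at[OF frame_has_vector_derivative[OF smooth]] N_def)
  qed
  then show ?thesis by (simp add: vec_eq_iff)
qed

definition eta where "eta v x = frame v x ** N x"
text \<open>The failure of \<open>\<delta>g\<close> to solve the linear equation
  \<open>y_x = y (b+u)\<close> satisfied by \<open>g\<close>. It vanishes identically exactly when
  \<open>\<delta>g = c g\<close> with a constant matrix \<open>c\<close>.\<close>

definition defect where "defect v x = frame (nth_vderiv 1 v) x - frame v x ** A x"

lemma smooth_eta: "smooth_on UNIV v \<Longrightarrow> smooth_on UNIV (eta v)"
  unfolding eta_def[abs_def]
  by (rule smooth_on_bilinear[OF open_UNIV bounded_bilinear_matrix_mult smooth_frame smooth_N])

lemma eta_has_vector_derivative:
  assumes "smooth_on UNIV v"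
  shows "(eta v has_vector_derivative defect v x ** N x) (at x)"
proof -
  have "(eta v has_vector_derivative frame v x ** - (N x ** frame (nth_vderiv 1 \<gamma>) x ** N x)
          + frame (nth_vderiv 1 v) x ** N x) (at x)"
    unfolding eta_def[abs_def]
    by (rule bounded_bilinear.has_vector_derivative[OF bounded_bilinear_matrix_mult
          frame_has_vector_derivative[OF assms] N_has_vector_derivative])
  then show ?thesis by (simp add: defect_def A_eq matrix_mult_bilinear_simps matrix_mul_assoc)
qed

lemma eta_periodic:
  "smooth_on UNIV v \<Longrightarrow> (\<And>x. v (x + 2 * pi) = v x) \<Longrightarrow> eta v (x + 2 * pi) = eta v x"
  by (simp add: eta_def N_periodic frame_periodic)

text \<open>The derivative of \<open>g^-1\<close> contributes \<open>- A g^-1 \<delta>g\<close>,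
  which cancels the first half of the commutator and leaves
  \<open>g^-1 ((\<delta>g)_x - \<delta>g A)\<close>.\<close>

lemma conn_bracket_eq:
  assumes "smooth_on UNIV v"
  shows "conn_bracket A (\<lambda>x. N x ** frame v x) x = N x ** defect v x"
proof -
  have "((\<lambda>x. N x ** frame v x) has_vector_derivative
     N x ** frame (nth_vderiv 1 v) x + - (N x ** frame (nth_vderiv 1 \<gamma>) x ** N x) ** frame v x) (at x)"
    by (rule bounded_bilinear.has_vector_derivative[OF bounded_bilinear_matrix_mult
          N_has_vector_derivative frame_has_vector_derivative[OF assms]])
  from vector_derivative_at[OF this] show ?thesis
    by (simp add: conn_bracket_def defect_def A_eq matrix_mult_bilinear_simps matrix_mul_assoc)
qed

lemma w2_hat_eq_bracket:
  assumes "smooth_on UNIV v\<^sub>1"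
  shows "w2_hat \<gamma> v\<^sub>1 v\<^sub>2 = integral {0..2 * pi} (\<lambda>x. trace ((N x ** defect v\<^sub>1 x) ** (N x ** frame v\<^sub>2 x)))"
  unfolding w2_hat_def loop_pairing_def A_def[symmetric] N_def[symmetric]
  using conn_bracket_eq[OF assms] by simp

text \<open>Cyclicity of the trace moves the leading \<open>g^-1\<close> to the end, which turns the
  conjugated bracket into the derivative of \<open>eta v\<^sub>1\<close>.\<close>

lemma w2_hat_eq:
  assumes "smooth_on UNIV v\<^sub>1"
  shows "w2_hat \<gamma> v\<^sub>1 v\<^sub>2 = integral {0..2 * pi} (\<lambda>x. trace (dderiv 1 (eta v\<^sub>1) x ** eta v\<^sub>2 x))"
proof -
  have "dderiv 1 (eta v\<^sub>1) x = defect v\<^sub>1 x ** N x" for x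
    using vector_derivative_at[OF eta_has_vector_derivative[OF assms]]
      vector_derivative_at[OF smooth_has_vector_derivative[OF smooth_eta[OF assms]]] by metis
  moreover have "trace ((N x ** defect v\<^sub>1 x) ** (N x ** frame v\<^sub>2 x)) = trace ((defect v\<^sub>1 x ** N x) ** eta v\<^sub>2 x)" for x
    unfolding eta_def using trace_mul_sym[of "N x" "defect v\<^sub>1 x ** (N x ** frame v\<^sub>2 x)"]
    by (simp add: matrix_mul_assoc)
  ultimately show ?thesis unfolding w2_hat_eq_bracket[OF assms] by simp
qed

text \<open>The frame is affine in \<open>s\<close>, so Jacobi's formula at \<open>s = 0\<close>,
  where the determinant is 1, turns the linearized constraint into a pointwise trace
  condition.\<close>

lemma mem_tangent_at_iff:
  "v \<in> tangent_at \<gamma> \<longleftrightarrow> smooth_loop v \<and> (\<forall>x. trace (N x ** frame v x) = 0)"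
proof (cases "smooth_loop v")
  case True
  then have s: "smooth_on UNIV v" by (simp add: smooth_loop_def)
  have D: "((\<lambda>s. det (frame (\<lambda>y. \<gamma> y + s *\<^sub>R v y) x)) has_real_derivative trace (N x ** frame v x)) (at 0)" for x
  proof -
    have fr: "frame (\<lambda>y. \<gamma> y + s *\<^sub>R v y) x = g x + s *\<^sub>R frame v x" for s
      using frame_lincomb[OF smooth s, of 1 s x] by simp
    have "((\<lambda>s. g x + s *\<^sub>R frame v x) has_vector_derivative frame v x) (at 0)"
      unfolding has_vector_derivative_def by (auto intro!: derivative_eq_intros)
    from has_real_derivative_det[OF this] show ?thesis unfolding fr by (simp add: det N_def)
  qed
  have "((\<lambda>s. det (frame (\<lambda>y. \<gamma> y + s *\<^sub>R v y) x)) has_real_derivative 0) (at 0)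
      \<longleftrightarrow> trace (N x ** frame v x) = 0" for x
    using D[of x] DERIV_unique[OF D[of x]] by fastforce
  then show ?thesis unfolding tangent_at_def using True by simp
qed (simp add: tangent_at_def)

end

section \<open>The form on tangent vectors\<close>

text \<open>A weak form of the Leibniz rule: only the coefficient of the highest derivative is made
  explicit, because the terms of lower order will be annihilated by the row of \<open>g^-1\<close>
  under consideration.\<close>

lemma nth_vderiv_scaleR_expansion:
  fixes a :: "real \<Rightarrow> real" and f :: "real \<Rightarrow> 'a::real_normed_vector"
  assumes "smooth_on UNIV a" "smooth_on UNIV f"
  shows "\<exists>c. (\<forall>i. smooth_on UNIV (c i)) \<and> (\<forall>x. nth_vderiv j (\<lambda>x. a x *\<^sub>R nth_vderiv m f x) x =
           a x *\<^sub>R nth_vderiv (m + j) f x + (\<Sum>i<j. c i x *\<^sub>R nth_vderiv (m + i) f x))"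
proof (induction j)
  case 0
  have "smooth_on UNIV (\<lambda>x::real. 0::real)" by (rule smooth_on_const)
  then show ?case by (intro exI[of _ "\<lambda>i x. 0"]) simp
next
  case (Suc j)
  then obtain c where c: "\<And>i. smooth_on UNIV (c i)"
    and e: "\<And>x. nth_vderiv j (\<lambda>x. a x *\<^sub>R nth_vderiv m f x) x =
           a x *\<^sub>R nth_vderiv (m + j) f x + (\<Sum>i<j. c i x *\<^sub>R nth_vderiv (m + i) f x)" by blast
  \<comment> \<open>The new coefficient at order \<open>m + i\<close> collects the derivative of the
    old one and the old coefficient one order below. At \<open>i = j\<close> the old coefficient is
    the leading one, \<open>a\<close>.\<close>
  define d where "d = (\<lambda>i x. (if i < j then dderiv 1 (c i) x else dderiv 1 a x) + (if i = 0 then 0 else c (i - 1) x))"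
  have d: "smooth_on UNIV (d i)" for i
    unfolding d_def
    by (rule smooth_on_add[OF open_UNIV]; cases "i < j"; cases "i = 0")
      (simp_all add: smooth_on_dderiv smooth_on_const assms c)
  have D: "((\<lambda>x. b x *\<^sub>R nth_vderiv k f x) has_vector_derivative
       b x *\<^sub>R nth_vderiv (Suc k) f x + dderiv 1 b x *\<^sub>R nth_vderiv k f x) (at x)"
    if "smooth_on UNIV b" for b :: "real \<Rightarrow> real" and k x
    by (rule bounded_bilinear.has_vector_derivative[OF bounded_bilinear_scaleR smooth_has_vector_derivative[OF that]
        nth_vderiv_has_vector_derivative[OF assms(2)]])
  have "nth_vderiv (Suc j) (\<lambda>x. a x *\<^sub>R nth_vderiv m f x) x =
           a x *\<^sub>R nth_vderiv (m + Suc j) f x + (\<Sum>i<Suc j. d i x *\<^sub>R nth_vderiv (m + i) f x)" for x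
  proof -
    have "nth_vderiv j (\<lambda>x. a x *\<^sub>R nth_vderiv m f x) =
       (\<lambda>x. a x *\<^sub>R nth_vderiv (m + j) f x + (\<Sum>i<j. c i x *\<^sub>R nth_vderiv (m + i) f x))"
      using e by (rule ext)
    moreover have "((\<lambda>x. a x *\<^sub>R nth_vderiv (m + j) f x + (\<Sum>i<j. c i x *\<^sub>R nth_vderiv (m + i) f x)) has_vector_derivative
       (a x *\<^sub>R nth_vderiv (Suc (m + j)) f x + dderiv 1 a x *\<^sub>R nth_vderiv (m + j) f x) +
       (\<Sum>i<j. c i x *\<^sub>R nth_vderiv (Suc (m + i)) f x + dderiv 1 (c i) x *\<^sub>R nth_vderiv (m + i) f x)) (at x)"
      by (rule has_vector_derivative_add[OF D[OF assms(1)] has_vector_derivative_sum[OF D[OF c]]])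
    ultimately have "nth_vderiv (Suc j) (\<lambda>x. a x *\<^sub>R nth_vderiv m f x) x =
       (a x *\<^sub>R nth_vderiv (Suc (m + j)) f x + dderiv 1 a x *\<^sub>R nth_vderiv (m + j) f x) +
       (\<Sum>i<j. c i x *\<^sub>R nth_vderiv (Suc (m + i)) f x + dderiv 1 (c i) x *\<^sub>R nth_vderiv (m + i) f x)"
      unfolding nth_vderiv_Suc by (simp only: vector_derivative_at)
    moreover have "(\<Sum>i<Suc j. d i x *\<^sub>R nth_vderiv (m + i) f x) =
       (\<Sum>i<Suc j. (if i < j then dderiv 1 (c i) x else dderiv 1 a x) *\<^sub>R nth_vderiv (m + i) f x) +
       (\<Sum>i<Suc j. (if i = 0 then 0 else c (i - 1) x) *\<^sub>R nth_vderiv (m + i) f x)"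
      unfolding d_def by (simp only: scaleR_add_left sum.distrib)
    moreover have "(\<Sum>i<Suc j. (if i < j then dderiv 1 (c i) x else dderiv 1 a x) *\<^sub>R nth_vderiv (m + i) f x) =
       (\<Sum>i<j. dderiv 1 (c i) x *\<^sub>R nth_vderiv (m + i) f x) + dderiv 1 a x *\<^sub>R nth_vderiv (m + j) f x"
      by simp
    moreover have "(\<Sum>i<Suc j. (if i = 0 then 0 else c (i - 1) x) *\<^sub>R nth_vderiv (m + i) f x) =
       (\<Sum>i<j. c i x *\<^sub>R nth_vderiv (Suc (m + i)) f x)"
      unfolding sum.lessThan_Suc_shift by simp
    ultimately show ?thesis by (simp add: sum.distrib)
  qed
  then show ?case using d by blast
qed

lemma periodic_eq_zero:
  fixes f :: "real \<Rightarrow> real"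
  assumes "\<And>x. f (x + T) = f x" "T > 0" "\<And>x. x \<in> {0..T} \<Longrightarrow> f x = 0"
  shows "f x = 0"
proof -
  interpret periodic_fun_simple f T by unfold_locales (rule assms(1))
  have "f x = f (x - of_int \<lfloor>x / T\<rfloor> * T)" by (simp add: minus_of_int)
  also have "\<dots> = 0"
  proof (rule assms(3))
    have "of_int \<lfloor>x / T\<rfloor> * T \<le> x"
      using assms(2) by (metis of_int_floor_le pos_le_divide_eq)
    moreover have "x < (of_int \<lfloor>x / T\<rfloor> + 1) * T"
      using assms(2) by (metis floor_correct of_int_1 of_int_add pos_divide_less_eq)
    ultimately show "x - of_int \<lfloor>x / T\<rfloor> * T \<in> {0..T}" by (simp add: algebra_simps)
  qed
  finally show ?thesis .
qed

lemma integral_derivative_periodic: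
  fixes f :: "real \<Rightarrow> 'a::banach"
  assumes "\<And>x. (f has_vector_derivative f' x) (at x)" "T \<ge> 0" "f T = f 0"
  shows "integral {0..T} f' = 0"
proof -
  have "(f' has_integral (f T - f 0)) {0..T}"
    by (rule fundamental_theorem_of_calculus[OF assms(2) has_vector_derivative_at_within[OF assms(1)]])
  then show ?thesis using assms(3) by (simp add: integral_unique)
qed

lemma trace_matrix_mult_bilinear: "bounded_bilinear (\<lambda>A B::real^'n^'n. trace (A ** B))"
  unfolding bilinear_conv_bounded_bilinear[symmetric] bilinear_def
  by (auto intro!: linearI simp: matrix_mult_bilinear_simps trace_linear_simps)

section \<open>Bilinearity and skew-symmetry of the form\<close>

context central_affine_curve
begin

lemma w2_hat_integrable:
  assumes "smooth_on UNIV v\<^sub>1" "smooth_on UNIV v\<^sub>2"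
  shows "(\<lambda>x. trace (dderiv 1 (eta v\<^sub>1) x ** eta v\<^sub>2 x)) integrable_on {a..b}"
proof -
  have "smooth_on UNIV (\<lambda>x. trace (dderiv 1 (eta v\<^sub>1) x ** eta v\<^sub>2 x))"
    by (rule smooth_on_bilinear[OF open_UNIV trace_matrix_mult_bilinear
          smooth_on_dderiv[OF smooth_eta[OF assms(1)]] smooth_eta[OF assms(2)]])
  from smooth_on_imp_continuous_on[OF this] show ?thesis
    by (intro integrable_continuous_interval) (rule continuous_on_subset, auto)
qed

lemma w2_hat_linear:
  assumes "smooth_on UNIV v\<^sub>1" "smooth_on UNIV v\<^sub>2" "smooth_on UNIV v\<^sub>3"
  shows "w2_hat \<gamma> (\<lambda>x. c *\<^sub>R v\<^sub>1 x + d *\<^sub>R v\<^sub>2 x) v\<^sub>3 = c * w2_hat \<gamma> v\<^sub>1 v\<^sub>3 + d * w2_hat \<gamma> v\<^sub>2 v\<^sub>3"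
proof -
  let ?v = "\<lambda>x. c *\<^sub>R v\<^sub>1 x + d *\<^sub>R v\<^sub>2 x"
  have s: "smooth_on UNIV ?v"
    by (rule smooth_on_add[OF open_UNIV]; rule smooth_on_linear[OF open_UNIV bounded_linear_scaleR_right]; fact)
  have eq: "eta ?v = (\<lambda>x. c *\<^sub>R eta v\<^sub>1 x + d *\<^sub>R eta v\<^sub>2 x)"
    by (rule ext) (simp add: eta_def frame_lincomb[OF assms(1,2)] matrix_mult_bilinear_simps)
  have D: "(eta ?v has_vector_derivative c *\<^sub>R dderiv 1 (eta v\<^sub>1) x + d *\<^sub>R dderiv 1 (eta v\<^sub>2) x) (at x)" for x
    unfolding eq
    by (rule has_vector_derivative_add;
        rule bounded_linear.has_vector_derivative[OF bounded_linear_scaleR_right];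
        rule smooth_has_vector_derivative[OF smooth_eta]; fact)
  have "dderiv 1 (eta ?v) x = c *\<^sub>R dderiv 1 (eta v\<^sub>1) x + d *\<^sub>R dderiv 1 (eta v\<^sub>2) x" for x
    by (rule vector_derivative_unique_at[OF smooth_has_vector_derivative[OF smooth_eta[OF s]] D])
  then have "w2_hat \<gamma> ?v v\<^sub>3 = integral {0..2*pi} (\<lambda>x. c * trace (dderiv 1 (eta v\<^sub>1) x ** eta v\<^sub>3 x)
      + d * trace (dderiv 1 (eta v\<^sub>2) x ** eta v\<^sub>3 x))"
    unfolding w2_hat_eq[OF s] by (simp add: matrix_mult_bilinear_simps trace_linear_simps)
  also have "\<dots> = c * w2_hat \<gamma> v\<^sub>1 v\<^sub>3 + d * w2_hat \<gamma> v\<^sub>2 v\<^sub>3"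
    unfolding w2_hat_eq[OF assms(1)] w2_hat_eq[OF assms(2)]
    using integral_add[OF integrable_on_cmult_left[OF w2_hat_integrable[OF assms(1,3)], of c 0 "2 * pi"]
        integrable_on_cmult_left[OF w2_hat_integrable[OF assms(2,3)], of d 0 "2 * pi"]]
    by simp
  finally show ?thesis .
qed

lemma w2_hat_skew:
  assumes "smooth_loop v\<^sub>1" "smooth_loop v\<^sub>2"
  shows "w2_hat \<gamma> v\<^sub>1 v\<^sub>2 = - w2_hat \<gamma> v\<^sub>2 v\<^sub>1"
proof -
  have s: "smooth_on UNIV v\<^sub>1" "smooth_on UNIV v\<^sub>2" using assms by (auto simp: smooth_loop_def)
  have p: "eta v (2 * pi) = eta v 0" if "smooth_loop v" for v
    using eta_periodic[of v 0] that by (simp add: smooth_loop_def)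
  have "integral {0..2 * pi} (\<lambda>x. trace (eta v\<^sub>1 x ** dderiv 1 (eta v\<^sub>2) x) + trace (dderiv 1 (eta v\<^sub>1) x ** eta v\<^sub>2 x)) = 0"
    by (rule integral_derivative_periodic[where f = "\<lambda>x. trace (eta v\<^sub>1 x ** eta v\<^sub>2 x)"],
        rule bounded_bilinear.has_vector_derivative[OF trace_matrix_mult_bilinear
          smooth_has_vector_derivative[OF smooth_eta[OF s(1)]] smooth_has_vector_derivative[OF smooth_eta[OF s(2)]]])
      (simp_all add: p assms)
  then have "integral {0..2 * pi} (\<lambda>x. trace (dderiv 1 (eta v\<^sub>2) x ** eta v\<^sub>1 x) + trace (dderiv 1 (eta v\<^sub>1) x ** eta v\<^sub>2 x)) = 0"
    by (simp add: trace_mul_sym[of "eta v\<^sub>1 x" for x])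
  then show ?thesis
    unfolding w2_hat_eq[OF s(1)] w2_hat_eq[OF s(2)]
    using integral_add[OF w2_hat_integrable[OF s(2,1), of 0 "2 * pi"] w2_hat_integrable[OF s, of 0 "2 * pi"]]
    by simp
qed

section \<open>The null space\<close>

lemma orbit_tangent_subset:
  assumes "trace c = 0"
  shows "(\<lambda>x. c *v \<gamma> x) \<in> null_space w2_hat \<gamma>"
proof -
  let ?v = "\<lambda>x. c *v \<gamma> x"
  have s: "smooth_on UNIV ?v"
    by (rule smooth_on_linear[OF open_UNIV matrix_vector_mul_bounded_linear smooth])
  have f: "frame ?v x = c ** g x" for x by (rule frame_matrix_vector_mult[OF smooth])
  have "trace (N x ** frame ?v x) = 0" for x
    unfolding f trace_mul_sym[of "N x"] by (simp add: assms)
  then have t: "?v \<in> tangent_at \<gamma>"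
    unfolding mem_tangent_at_iff smooth_loop_def using s periodic by simp
  have "eta ?v = (\<lambda>x. c)" by (rule ext) (simp add: eta_def f)
  then have "dderiv 1 (eta ?v) x = 0" for x by (simp add: dderiv_def)
  then have "w2_hat \<gamma> ?v v\<^sub>2 = 0" for v\<^sub>2
    unfolding w2_hat_eq[OF s] by (simp add: matrix_mult_bilinear_simps trace_linear_simps)
  then show ?thesis unfolding null_space_def using t by simp
qed

text \<open>Column \<open>c\<close> of the frame of \<open>a \<gamma>^(m)\<close> involves
  derivatives of \<gamma> of order at most \<open>m + pos c\<close>, the highest one with
  coefficient \<open>a\<close>. In the coordinates given by \<open>g^-1\<close> such a column is
  zero below row \<open>m + pos c\<close> and equals \<open>a\<close> in it. The hypothesis keeps
  all orders below n, where each derivative is a column of \<open>g\<close>.\<close>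

lemma N_mult_frame_scaleR:
  assumes "smooth_on UNIV a" "m + pos c \<le> pos (r::'n)"
  shows "(N x ** frame (\<lambda>x. a x *\<^sub>R nth_vderiv m \<gamma> x) x) $ r $ c = (if m + pos c = pos r then a x else 0)"
proof -
  obtain d where d: "\<And>x. nth_vderiv (pos c) (\<lambda>x. a x *\<^sub>R nth_vderiv m \<gamma> x) x =
           a x *\<^sub>R nth_vderiv (m + pos c) \<gamma> x + (\<Sum>i<pos c. d i x *\<^sub>R nth_vderiv (m + i) \<gamma> x)"
    using nth_vderiv_scaleR_expansion[OF assms(1) smooth, of "pos c" m] by blast
  have r: "pos r < CARD('n)" by (rule pos_less_card)
  interpret L: linear "(*v) (N x)" by (rule matrix_vector_mul_linear)
  have "(N x *v nth_vderiv (pos c) (\<lambda>x. a x *\<^sub>R nth_vderiv m \<gamma> x) x) $ r =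
     a x * (N x *v nth_vderiv (m + pos c) \<gamma> x) $ r + (\<Sum>i<pos c. d i x * (N x *v nth_vderiv (m + i) \<gamma> x) $ r)"
    unfolding d L.add L.sum L.scale by (simp add: sum_component)
  also have "(\<Sum>i<pos c. d i x * (N x *v nth_vderiv (m + i) \<gamma> x) $ r) = 0"
    using assms(2) r by (intro sum.neutral) (auto simp: N_mult_nth_vderiv)
  also have "(N x *v nth_vderiv (m + pos c) \<gamma> x) $ r = (if m + pos c = pos r then 1 else 0)"
    using assms(2) r by (subst N_mult_nth_vderiv) auto
  finally show ?thesis unfolding matrix_mult_frame_nth by simp
qed

text \<open>The matrix \<open>g^-1 frame (h \<gamma>)\<close> has \<open>h\<close> all along its
  diagonal, so adding \<open>h \<gamma>\<close> changes the trace by \<open>n h\<close>. Taking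
  \<open>h\<close> as \<open>-1/n\<close> times the trace for \<open>v\<close> restores tangency,
  and \<open>h\<close> inherits smoothness and periodicity.\<close>

lemma tangent_completion:
  assumes "smooth_on UNIV v" "\<And>x. v (x + 2 * pi) = v x"
  shows "\<exists>h. smooth_on UNIV h \<and> (\<lambda>x. h x *\<^sub>R \<gamma> x + v x) \<in> tangent_at \<gamma>"
proof -
  define h where "h = (\<lambda>x. (- 1 / real CARD('n)) * trace (N x ** frame v x))"
  have sh: "smooth_on UNIV h" unfolding h_def
    by (rule smooth_on_linear[OF open_UNIV bounded_linear_mult_right
          smooth_on_bilinear[OF open_UNIV trace_matrix_mult_bilinear smooth_N smooth_frame[OF assms(1)]]])
  have ph: "h (x + 2 * pi) = h x" for x
    unfolding h_def by (simp add: N_periodic frame_periodic[OF assms])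
  have shg: "smooth_on UNIV (\<lambda>x. h x *\<^sub>R \<gamma> x)"
    by (rule smooth_on_bilinear[OF open_UNIV bounded_bilinear_scaleR sh smooth])
  have "trace (N x ** frame (\<lambda>x. h x *\<^sub>R \<gamma> x + v x) x) = 0" for x
  proof -
    have "(N x ** frame (\<lambda>x. h x *\<^sub>R \<gamma> x) x) $ i $ i = h x" for i
      using N_mult_frame_scaleR[OF sh, of 0 i i x] by simp
    then have "trace (N x ** frame (\<lambda>x. h x *\<^sub>R \<gamma> x) x) = real CARD('n) * h x"
      unfolding trace_def by simp
    moreover have "frame (\<lambda>x. h x *\<^sub>R \<gamma> x + v x) x = frame (\<lambda>x. h x *\<^sub>R \<gamma> x) x + frame v x"
      using frame_lincomb[OF shg assms(1), of 1 1 x] by simp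
    ultimately show ?thesis
      by (simp add: matrix_mult_bilinear_simps trace_linear_simps h_def)
  qed
  then have "(\<lambda>x. h x *\<^sub>R \<gamma> x + v x) \<in> tangent_at \<gamma>"
    unfolding mem_tangent_at_iff smooth_loop_def
    using smooth_on_add[OF open_UNIV shg assms(1)] by (simp add: ph periodic assms(2))
  then show ?thesis using sh by blast
qed

text \<open>Differentiation and multiplication by \<open>b_mat\<close> shift the columns of the
  frame of \<open>v\<close> in the same way, and \<open>curvature\<close> affects only the last
  column of the product.\<close>

lemma defect_nth:
  assumes "smooth_on UNIV v" "j \<noteq> Max UNIV"
  shows "defect v x $ i $ j = 0"
proof -
  obtain k :: 'n where k: "pos k = Suc (pos j)" using ex_Suc_pos[OF assms(2)] by blast
  have "(frame v x ** A x) $ i $ j = (frame v x ** b_mat) $ i $ j"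
    using assms(2) by (simp add: A_def matrix_matrix_mult_def curvature_def)
  also have "\<dots> = frame v x $ i $ k" by (rule matrix_mult_b_mat_nth[OF k])
  finally show ?thesis by (simp add: defect_def frame_vderiv_nth[OF assms(1) k] del: One_nat_def)
qed

lemma trace_bracket:
  assumes "smooth_on UNIV v"
  shows "trace ((N x ** defect v x) ** B) = (\<Sum>i\<in>UNIV. (N x ** defect v x) $ i $ Max UNIV * B $ Max UNIV $ i)"
proof -
  have z: "(N x ** defect v x) $ i $ j = 0" if "j \<noteq> Max UNIV" for i j
    unfolding matrix_matrix_mult_def by (simp add: defect_nth[OF assms that])
  have "(\<Sum>k\<in>UNIV. (N x ** defect v x) $ i $ k * B $ k $ i)
      = (\<Sum>k\<in>{Max UNIV}. (N x ** defect v x) $ i $ k * B $ k $ i)" for i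
    by (rule sum.mono_neutral_right) (auto simp: z)
  then show ?thesis
    unfolding trace_def matrix_matrix_mult_def[of "N x ** defect v x"] by simp
qed

text \<open>The bracket has a single nonzero column \<open>p\<close>. Its last entry vanishes since the trace does; the
  others vanish from the bottom up, as pairing with \<open>\<delta>\<gamma> = h \<gamma> + p\<^sub>k \<gamma>\<^sub>x\<^bsup>(n-k)\<^esup>\<close> gives \<open>\<oint> p\<^sub>k\<^sup>2 dx\<close>.\<close>

lemma null_space_defect_zero:
  assumes "v \<in> null_space w2_hat \<gamma>"
  shows "N x ** defect v x = 0"
proof -
  have t: "v \<in> tangent_at \<gamma>" and null: "\<And>u. u \<in> tangent_at \<gamma> \<Longrightarrow> w2_hat \<gamma> v u = 0"
    using assms unfolding null_space_def by auto
  have s: "smooth_on UNIV v" and per: "\<And>x. v (x + 2 * pi) = v x" and tr: "\<And>x. trace (N x ** frame v x) = 0"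
    using t unfolding mem_tangent_at_iff smooth_loop_def by auto
  have sd: "smooth_on UNIV (\<lambda>x. N x ** defect v x)"
  proof -
    have 1: "smooth_on UNIV (\<lambda>x. dderiv 1 (eta v) x ** g x)"
      by (rule smooth_on_bilinear[OF open_UNIV bounded_bilinear_matrix_mult
            smooth_on_dderiv[OF smooth_eta[OF s]] smooth_frame[OF smooth]])
    have "dderiv 1 (eta v) x ** g x = defect v x" for x
      using vector_derivative_unique_at[OF smooth_has_vector_derivative[OF smooth_eta[OF s]]
          eta_has_vector_derivative[OF s], of x] by simp
    then have "smooth_on UNIV (defect v)" using 1 by simp
    then show ?thesis
      by (rule smooth_on_bilinear[OF open_UNIV bounded_bilinear_matrix_mult smooth_N])
  qed
  define p where "p = (\<lambda>k x. (N x ** defect v x) $ k $ Max UNIV)"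
  have sp: "smooth_on UNIV (p k)" for k
    unfolding p_def by (rule smooth_on_vec_nth[OF open_UNIV smooth_on_vec_nth[OF open_UNIV sd]])
  have pp: "p k (x + 2 * pi) = p k x" for k x
  proof -
    have "frame (nth_vderiv 1 v) (x + 2 * pi) = frame (nth_vderiv 1 v) x"
      by (rule frame_periodic[OF smooth_vderiv[OF s] nth_vderiv_periodic[OF s per]])
    moreover have "frame (nth_vderiv 1 \<gamma>) (x + 2 * pi) = frame (nth_vderiv 1 \<gamma>) x"
      by (rule frame_periodic[OF smooth_vderiv[OF smooth] nth_vderiv_periodic[OF smooth periodic]])
    ultimately show ?thesis
      unfolding p_def defect_def A_eq by (simp add: N_periodic frame_periodic[OF s per] del: One_nat_def)
  qed
  have w: "w2_hat \<gamma> v u = integral {0..2 * pi} (\<lambda>x. \<Sum>i\<in>UNIV. p i x * (N x ** frame u x) $ Max UNIV $ i)" for u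
    unfolding w2_hat_eq_bracket[OF s] trace_bracket[OF s] p_def ..
  have "p k x = 0" for k :: 'n and x
  \<comment> \<open>This measure decreases as \<open>k\<close> grows, so the hypothesis covers all
    rows below row \<open>k\<close>.\<close>
  proof (induction "CARD('n) - pos k" arbitrary: k x rule: less_induct)
    case less
    have later: "p i y = 0" if "k < i" for i y
      using less.hyps[of i y] that pos_less_iff[of k i] pos_less_card[of i] by simp
    show ?case
    proof (cases "k = Max UNIV")
      \<comment> \<open>Here the test vector would be a multiple of \<gamma> itself, a direction
        already used up by the correction \<open>h \<gamma>\<close>; the trace constraint on
        \<open>v\<close> is used instead.\<close>
      case True
      have "((\<lambda>x. trace (eta v x)) has_vector_derivative trace (defect v x ** N x)) (at x)"
        by (rule bounded_linear.has_vector_derivative[OF bounded_linear_trace eta_has_vector_derivative[OF s]])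
      moreover have "trace (eta v x) = 0" for x
        using tr[of x] unfolding eta_def trace_mul_sym[of "N x"] .
      ultimately have "((\<lambda>x. 0) has_vector_derivative trace (defect v x ** N x)) (at x)" by simp
      then have "trace (defect v x ** N x) = 0"
        by (rule vector_derivative_unique_at[OF _ has_vector_derivative_const])
      then have "trace ((N x ** defect v x) ** mat 1) = 0"
        unfolding trace_mul_sym[of "N x"] matrix_mul_rid .
      then show ?thesis unfolding trace_bracket[OF s] True p_def
        by (simp add: mat_def mult_delta_right)
    next
      case False
      then have kM: "k < Max UNIV" by (simp add: order_less_le)
      then have kM': "pos k < pos (Max UNIV :: 'n)" by (simp add: pos_less_iff)
      \<comment> \<open>Chosen so that \<open>m + pos k = n - 1\<close>: among the columns up to
        \<open>k\<close>, the frame of \<open>p k \<gamma>^(m)\<close> reaches the last row only in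
        column \<open>k\<close>.\<close>
      define m where "m = pos (Max UNIV :: 'n) - pos k"
      let ?w = "\<lambda>x. p k x *\<^sub>R nth_vderiv m \<gamma> x"
      have sw: "smooth_on UNIV ?w"
        by (rule smooth_on_bilinear[OF open_UNIV bounded_bilinear_scaleR sp smooth_nth_vderiv[OF smooth]])
      obtain h where h: "smooth_on UNIV h" and T: "(\<lambda>x. h x *\<^sub>R \<gamma> x + ?w x) \<in> tangent_at \<gamma>"
        using tangent_completion[OF sw] pp nth_vderiv_periodic[OF smooth periodic] by auto
      have shg: "smooth_on UNIV (\<lambda>x. h x *\<^sub>R \<gamma> x)"
        by (rule smooth_on_bilinear[OF open_UNIV bounded_bilinear_scaleR h smooth])
      have E: "(N x ** frame (\<lambda>x. h x *\<^sub>R \<gamma> x + ?w x) x) $ Max UNIV $ i = (if i = k then p k x else 0)"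
        if "i \<le> k" for i x
      proof -
        have i: "pos i \<le> pos k" using that by (metis not_less pos_less_iff)
        have "frame (\<lambda>x. h x *\<^sub>R \<gamma> x + ?w x) x = frame (\<lambda>x. h x *\<^sub>R \<gamma> x) x + frame ?w x"
          using frame_lincomb[OF shg sw, of 1 1 x] by simp
        then have "(N x ** frame (\<lambda>x. h x *\<^sub>R \<gamma> x + ?w x) x) $ Max UNIV $ i =
            (N x ** frame (\<lambda>x. h x *\<^sub>R \<gamma> x) x) $ Max UNIV $ i + (N x ** frame ?w x) $ Max UNIV $ i"
          by (simp add: matrix_mult_bilinear_simps)
        also have "(N x ** frame (\<lambda>x. h x *\<^sub>R \<gamma> x) x) $ Max UNIV $ i = 0"
          using N_mult_frame_scaleR[OF h, of 0 i "Max UNIV" x] i kM' by simp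
        also have "(N x ** frame ?w x) $ Max UNIV $ i = (if m + pos i = pos (Max UNIV :: 'n) then p k x else 0)"
          by (rule N_mult_frame_scaleR[OF sp]) (use i kM' in \<open>simp add: m_def\<close>)
        also have "m + pos i = pos (Max UNIV :: 'n) \<longleftrightarrow> i = k"
          using kM' i pos_inject[of i k] by (auto simp: m_def)
        finally show ?thesis by simp
      qed
      have "(\<Sum>i\<in>UNIV. p i x * (N x ** frame (\<lambda>x. h x *\<^sub>R \<gamma> x + ?w x) x) $ Max UNIV $ i) = (p k x)\<^sup>2" for x
      proof -
        \<comment> \<open>Columns after \<open>k\<close> of the test matrix are not controlled, but
          there \<open>p i\<close> vanishes by induction.\<close>
        have "p i x * (N x ** frame (\<lambda>x. h x *\<^sub>R \<gamma> x + ?w x) x) $ Max UNIV $ i = (if i = k then (p k x)\<^sup>2 else 0)" for i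
          using E[of i x] later[of i x] by (cases "i \<le> k") (auto simp: power2_eq_square)
        then show ?thesis by simp
      qed
      then have int0: "integral {0..2 * pi} (\<lambda>x. (p k x)\<^sup>2) = 0"
        using null[OF T] unfolding w by simp
      have "continuous_on {0..2 * pi} (\<lambda>x. (p k x)\<^sup>2)"
        using smooth_on_imp_continuous_on[OF sp, of k] by (intro continuous_intros) (rule continuous_on_subset, auto)
      then have "\<forall>x\<in>{0..2 * pi}. (p k x)\<^sup>2 = 0"
        using int0 by (subst (asm) integral_eq_0_iff) auto
      then have "p k y = 0" if "y \<in> {0..2 * pi}" for y using that by simp
      then show ?thesis by (rule periodic_eq_zero[of "p k" "2 * pi", rotated 2]) (auto simp: pp)
    qed
  qed
  moreover have "(N x ** defect v x) $ i $ j = 0" if "j \<noteq> Max UNIV" for i j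
    unfolding matrix_matrix_mult_def by (simp add: defect_nth[OF s that])
  ultimately show ?thesis unfolding p_def by (simp add: vec_eq_iff) metis
qed

text \<open>Once the frame of \<open>v\<close> is \<open>c g\<close>, its column at position 0 reads
  \<open>v = c \<gamma>\<close>. Tangency at a single point gives \<open>trace c = 0\<close>, since
  conjugation by \<open>g\<close> preserves the trace.\<close>

lemma null_space_subset:
  assumes "v \<in> null_space w2_hat \<gamma>"
  shows "v \<in> orbit_tangent_at \<gamma>"
proof -
  have s: "smooth_on UNIV v" and tr: "\<And>x. trace (N x ** frame v x) = 0"
    using assms unfolding null_space_def by (auto simp: mem_tangent_at_iff smooth_loop_def)
  have "defect v x = g x ** (N x ** defect v x)" for x by simp
  then have "defect v x = 0" for x
    unfolding null_space_defect_zero[OF assms] by (simp add: matrix_mult_bilinear_simps)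
  then have "(eta v has_vector_derivative 0) (at x)" for x
    using eta_has_vector_derivative[OF s, of x] by (simp add: matrix_mult_bilinear_simps)
  then have "\<exists>c. \<forall>x\<in>UNIV. eta v x = c"
    by (intro has_derivative_zero_constant) (auto simp: has_vector_derivative_def)
  then obtain c where c: "\<And>x. eta v x = c" by blast
  have f: "frame v x = c ** g x" for x
    using c[of x] by (metis eta_def N_cancel(3))
  obtain z :: 'n where z: "pos z = 0" using ex_pos[of 0] by auto
  have "v x = c *v \<gamma> x" for x
  proof -
    have "v x $ i = frame v x $ i $ z" for i by (simp add: frame_def z)
    also have "frame v x $ i $ z = (c *v \<gamma> x) $ i" for i
      unfolding f matrix_mult_frame_nth z by simp
    finally show ?thesis by (simp add: vec_eq_iff)
  qed
  moreover have "trace c = 0"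
    using tr[of 0] c[of 0] by (metis eta_def trace_mul_sym)
  ultimately show ?thesis unfolding orbit_tangent_at_def by blast
qed

lemma null_space_eq: "null_space w2_hat \<gamma> = orbit_tangent_at \<gamma>"
  using null_space_subset orbit_tangent_subset unfolding orbit_tangent_at_def by fast

end

text \<open>Only \<open>g^-1 \<delta>g\<close> and \<open>g^-1 g_x\<close> enter the form, and a
  constant left factor \<open>c\<close> cancels in both. The fact \<open>quot\<close> is this
  cancellation.\<close>

lemma SL_invariant_w2_hat: "SL_invariant (w2_hat :: 'n::{finite,linorder} curve_form)"
  unfolding SL_invariant_def
proof (intro allI impI ballI)
  fix c :: "'n sq_matrix" and \<gamma> v\<^sub>1 v\<^sub>2 :: "'n curve"
  assume c: "det c = 1" and g: "\<gamma> \<in> central_affine_curves"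
    and v: "v\<^sub>1 \<in> tangent_at \<gamma>" "v\<^sub>2 \<in> tangent_at \<gamma>"
  interpret central_affine_curve \<gamma> by unfold_locales (rule g)
  have s: "smooth_on UNIV v\<^sub>1" "smooth_on UNIV v\<^sub>2"
    using v by (auto simp: mem_tangent_at_iff smooth_loop_def)
  note fr = frame_matrix_vector_mult
  have "det c \<noteq> 0" using c by simp
  note ci = matrix_inv_mult[OF this]
  have inv: "matrix_inv (c ** g x) = N x ** matrix_inv c" for x
  proof (rule matrix_inv_unique)
    have "c ** g x ** (N x ** matrix_inv c) = c ** (g x ** N x) ** matrix_inv c"
      by (simp only: matrix_mul_assoc)
    then show "c ** g x ** (N x ** matrix_inv c) = mat 1" by (simp add: N_mult ci)
  qed
  have quot: "matrix_inv (c ** g x) ** (c ** B) = N x ** B" for x B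
  proof -
    have "matrix_inv (c ** g x) ** (c ** B) = N x ** (matrix_inv c ** c) ** B"
      unfolding inv by (simp only: matrix_mul_assoc)
    then show ?thesis by (simp add: ci)
  qed
  have "vector_derivative (frame (\<lambda>x. c *v \<gamma> x)) (at x) = c ** vector_derivative g (at x)" for x
  proof -
    have "frame (\<lambda>x. c *v \<gamma> x) = (\<lambda>x. c ** g x)" using fr[OF smooth] by (rule ext)
    moreover have "((\<lambda>x. c ** g x) has_vector_derivative c ** frame (nth_vderiv 1 \<gamma>) x) (at x)"
      by (rule bounded_linear.has_vector_derivative[OF
            bounded_bilinear.bounded_linear_right[OF bounded_bilinear_matrix_mult] frame_has_vector_derivative[OF smooth]])
    ultimately show ?thesis
      using vector_derivative_at[OF frame_has_vector_derivative[OF smooth]] by (simp only: vector_derivative_at)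
  qed
  then have "curvature (\<lambda>x. c *v \<gamma> x) x = curvature \<gamma> x" for x
    unfolding curvature_def fr[OF smooth] by (simp only: quot N_def)
  then show "w2_hat (\<lambda>x. c *v \<gamma> x) (\<lambda>x. c *v v\<^sub>1 x) (\<lambda>x. c *v v\<^sub>2 x) = w2_hat \<gamma> v\<^sub>1 v\<^sub>2"
    unfolding w2_hat_def fr[OF smooth] fr[OF s(1)] fr[OF s(2)] by (simp only: quot N_def)
qed

section \<open>Families of curves and closedness\<close>

lemma has_vector_derivative_slice:
  fixes F :: "'e::real_normed_vector \<times> real \<Rightarrow> 'b::real_normed_vector"
  assumes "smooth_on (U \<times> UNIV) F" "p \<in> U"
  shows "((\<lambda>x. F (p, x)) has_vector_derivative dderiv (0, 1) F (p, x)) (at x)"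
  using smooth_on_has_vector_derivative_line[OF assms(1), of "(p, 0)" x "(0, 1)"] assms(2) by simp

lemma smooth_on_slice:
  fixes F :: "'e::real_normed_vector \<times> real \<Rightarrow> 'b::real_normed_vector"
  assumes "smooth_on (U \<times> UNIV) F" "p \<in> U"
  shows "smooth_on UNIV (\<lambda>x. F (p, x))"
proof -
  have "smooth_on UNIV (\<lambda>x. F ((p, 0) + (0, x)))"
    by (rule smooth_on_affine_compose[OF open_UNIV _ assms(1)])
      (use assms(2) in \<open>auto intro: bounded_linear_Pair bounded_linear_ident bounded_linear_zero\<close>)
  then show ?thesis by simp
qed

lemma dderiv_slice:
  fixes F :: "'e::real_normed_vector \<times> real \<Rightarrow> 'b::real_normed_vector"
  assumes "smooth_on (U \<times> UNIV) F" "p \<in> U"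
  shows "dderiv 1 (\<lambda>x. F (p, x)) x = dderiv (0, 1) F (p, x)"
  by (rule vector_derivative_unique_at[OF smooth_has_vector_derivative[OF smooth_on_slice[OF assms]]
        has_vector_derivative_slice[OF assms]])

lemma smooth_on_funpow_dderiv: "smooth_on S f \<Longrightarrow> smooth_on S ((dderiv v ^^ k) f)"
  by (induction k) (simp_all add: smooth_on_dderiv)

lemma nth_vderiv_slice:
  fixes F :: "'e::real_normed_vector \<times> real \<Rightarrow> 'b::real_normed_vector"
  assumes "smooth_on (U \<times> UNIV) F" "p \<in> U"
  shows "nth_vderiv k (\<lambda>x. F (p, x)) = (\<lambda>x. (dderiv (0, 1) ^^ k) F (p, x))"
  by (rule nth_vderiv_unique[of "\<lambda>k x. (dderiv (0, 1) ^^ k) F (p, x)"])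
    (use has_vector_derivative_slice[OF smooth_on_funpow_dderiv[OF assms(1)] assms(2)] in auto)

text \<open>With \<open>v\<close> the x-direction and \<open>w\<close> a parameter direction, this
  lets the frame of a variation be read as a parameter derivative of the frame.\<close>

lemma dderiv_funpow_commute:
  fixes f :: "'a::real_normed_vector \<Rightarrow> 'b::banach"
  assumes "open S" "smooth_on S f" "x \<in> S"
  shows "dderiv w ((dderiv v ^^ k) f) x = (dderiv v ^^ k) (dderiv w f) x"
  using assms(3)
proof (induction k arbitrary: x)
  case (Suc k)
  have "dderiv w (dderiv v ((dderiv v ^^ k) f)) x = dderiv v (dderiv w ((dderiv v ^^ k) f)) x"
    by (rule dderiv_commute[OF assms(1) smooth_on_funpow_dderiv[OF assms(2)] Suc.prems])
  also have "\<dots> = dderiv v ((dderiv v ^^ k) (dderiv w f)) x"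
    by (rule dderiv_cong_open[OF assms(1) Suc.prems Suc.IH _])
      (assumption, rule smooth_on_imp_differentiable[OF smooth_on_dderiv[OF smooth_on_funpow_dderiv[OF assms(2)]] Suc.prems])
  finally show ?case by simp
qed simp

lemma dderiv_periodic:
  fixes F :: "'e::real_normed_vector \<times> real \<Rightarrow> 'b::real_normed_vector"
  assumes "open U" "smooth_on (U \<times> UNIV) F" "\<And>p x. p \<in> U \<Longrightarrow> F (p, x + T) = F (p, x)" "p \<in> U"
  shows "dderiv v F (p, x + T) = dderiv v F (p, x)"
proof -
  have S: "open (U \<times> (UNIV :: real set))" using assms(1) by (simp add: open_Times)
  have "(F has_derivative (\<lambda>v. dderiv v F (p, x + T))) (at ((0, T) + (p, x)))"
    using smooth_on_has_derivative[OF assms(2), of "(p, x + T)"] assms(4) by (simp add: add.commute)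
  then have D: "((\<lambda>z. F ((0, T) + z)) has_derivative (\<lambda>v. dderiv v F (p, x + T))) (at (p, x))"
    by (rule has_derivative_compose[rotated, where f = "\<lambda>z. (0, T) + z"]) (auto intro!: derivative_eq_intros)
  have "dderiv v F (p, x) = dderiv v (\<lambda>z. F ((0, T) + z)) (p, x)"
    by (rule dderiv_cong_open[OF S])
      (use assms in \<open>auto simp: add.commute intro: smooth_on_imp_differentiable\<close>)
  then show ?thesis by (simp add: dderiv_eq[OF D])
qed

text \<open>\<open>AB\<close> stands for the derivative of the field \<open>B\<close> in direction
  a, \<open>ABx\<close> for its x-derivative; the hypotheses are Maurer-Cartan equations. The left
  side is the integrand of the exterior derivative, the right side the product rule for its
  primitive. Exchanging \<open>BA\<close>, \<open>CB\<close>, \<open>AC\<close> for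
  \<open>AB\<close>, \<open>BC\<close>, \<open>CA\<close> costs three commutators, which together
  form the x-derivative of \<open>tr (C (BA - AB))\<close>, with matrix products here.\<close>

lemma trace_cyclic_identity:
  fixes A B C Ax Bx Cx AB BA BC CB CA AC ABx BCx CAx :: "real^'n^'n"
  assumes "AB - BA = A ** B - B ** A" "BC - CB = B ** C - C ** B" "CA - AC = C ** A - A ** C"
  shows "(trace (Bx ** AC) + trace (ABx ** C)) + (trace (Cx ** BA) + trace (BCx ** A)) + (trace (Ax ** CB) + trace (CAx ** B))
    = (trace (AB ** Cx) + trace (ABx ** C)) + (trace (BC ** Ax) + trace (BCx ** A)) + (trace (CA ** Bx) + trace (CAx ** B))
      + (trace (C ** ((B ** Ax + Bx ** A) - (A ** Bx + Ax ** B))) + trace (Cx ** (B ** A - A ** B)))"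
proof -
  have e: "BA = AB - (A ** B - B ** A)" "CB = BC - (B ** C - C ** B)" "AC = CA - (C ** A - A ** C)"
    using assms by (simp_all add: algebra_simps)
  have c: "trace (C ** (B ** Ax)) = trace (Ax ** (C ** B))" "trace (C ** (Ax ** B)) = trace (Ax ** (B ** C))"
    "trace (C ** (Bx ** A)) = trace (Bx ** (A ** C))" "trace (C ** (A ** Bx)) = trace (Bx ** (C ** A))"
    by (metis matrix_mul_assoc trace_mul_sym)+
  have d: "trace (AB ** Cx) = trace (Cx ** AB)" "trace (BC ** Ax) = trace (Ax ** BC)" "trace (CA ** Bx) = trace (Bx ** CA)"
    by (rule trace_mul_sym)+
  show ?thesis unfolding e d by (simp add: matrix_mult_bilinear_simps trace_linear_simps c)
qed

section \<open>Pullback of the form to a three-parameter family\<close>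

locale curve_family =
  fixes U :: "(real^3) set" and \<Gamma> :: "real^3 \<Rightarrow> 'n::{finite,linorder} curve"
  assumes family: "smooth_family U \<Gamma>"
begin

abbreviation "S \<equiv> U \<times> (UNIV :: real set)"

definition \<Phi> where "\<Phi> = (\<lambda>(p, x). \<Gamma> p x)"
text \<open>The moving frame as a function of parameters and x jointly. Its x-derivatives are
  directional derivatives along \<open>(0, 1)\<close>, so joint smoothness and commutation with
  parameter derivatives are available.\<close>

definition G :: "(real^3) \<times> real \<Rightarrow> 'n sq_matrix" where
  "G z = (\<chi> i j. (dderiv (0, 1) ^^ pos j) \<Phi> z $ i)"
definition M where "M z = matrix_inv (G z)"
text \<open>The right-invariant form \<open>dg g^-1\<close> evaluated on the constant field
  \<open>a\<close>; on each curve of the family it is \<open>eta\<close> of the variation.\<close>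

definition R where "R a z = dderiv (a, 0) G z ** M z"

lemma open_U: "open U" and open_S: "open S" and smooth_\<Phi>: "smooth_on S \<Phi>"
  and curve_\<Gamma>: "p \<in> U \<Longrightarrow> \<Gamma> p \<in> central_affine_curves"
  using family unfolding smooth_family_def \<Phi>_def by (auto intro: open_Times)

lemma central_affine: "p \<in> U \<Longrightarrow> central_affine_curve (\<Gamma> p)"
  by (simp add: central_affine_curve_def curve_\<Gamma>)

lemma \<Phi>_Pair: "\<Phi> (p, x) = \<Gamma> p x"
  by (simp add: \<Phi>_def)

lemma smooth_G: "smooth_on S G"
  unfolding G_def[abs_def]
  by (rule smooth_on_matrix_of_columns[OF open_S smooth_on_funpow_dderiv[OF smooth_\<Phi>]])

lemma frame_eq_G:
  assumes "p \<in> U"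
  shows "frame (\<Gamma> p) x = G (p, x)"
  using nth_vderiv_slice[OF smooth_\<Phi> assms] unfolding frame_def G_def \<Phi>_Pair by simp

lemma variation_eq:
  assumes "p \<in> U"
  shows "variation \<Gamma> p a = (\<lambda>x. dderiv (a, 0) \<Phi> (p, x))"
proof
  fix x
  have "(\<Phi> has_derivative (\<lambda>v. dderiv v \<Phi> (p, x))) (at (p, x))"
    using smooth_on_has_derivative[OF smooth_\<Phi>] assms by simp
  then have "((\<lambda>q. \<Phi> (q, x)) has_derivative (\<lambda>a. dderiv (a, 0) \<Phi> (p, x))) (at p)"
    by (rule has_derivative_compose[rotated, where f = "\<lambda>q. (q, x)"]) (auto intro!: derivative_eq_intros)
  from frechet_derivative_at[OF this, symmetric]
  show "variation \<Gamma> p a x = dderiv (a, 0) \<Phi> (p, x)"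
    unfolding variation_def \<Phi>_Pair by (rule fun_cong)
qed

lemma frame_variation:
  assumes "p \<in> U"
  shows "frame (variation \<Gamma> p a) x = dderiv (a, 0) G (p, x)"
proof -
  have z: "(p, x) \<in> S" using assms by simp
  have "(G has_derivative (\<lambda>h. \<chi> i j. dderiv h ((dderiv (0, 1) ^^ pos j) \<Phi>) (p, x) $ i)) (at (p, x))"
    unfolding G_def[abs_def]
    by (rule has_derivative_matrix_of_columns)
      (rule smooth_on_has_derivative[OF smooth_on_funpow_dderiv[OF smooth_\<Phi>] z])
  from dderiv_eq[OF this, of "(a, 0)"] show ?thesis
    unfolding frame_def variation_eq[OF assms] nth_vderiv_slice[OF smooth_on_dderiv[OF smooth_\<Phi>] assms]
    by (simp add: dderiv_funpow_commute[OF open_S smooth_\<Phi> z])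
qed

lemma det_G: "z \<in> S \<Longrightarrow> det (G z) = 1"
  using central_affine_curve.det[OF central_affine] frame_eq_G by (metis SigmaE)

lemma smooth_M: "smooth_on S M"
  unfolding M_def[abs_def] by (rule smooth_on_matrix_inv[OF open_S smooth_G det_G])

lemma smooth_R: "smooth_on S (R a)"
  unfolding R_def[abs_def]
  by (rule smooth_on_bilinear[OF open_S bounded_bilinear_matrix_mult smooth_on_dderiv[OF smooth_G] smooth_M])

lemma G_periodic:
  assumes "p \<in> U"
  shows "G (p, x + 2 * pi) = G (p, x)"
proof -
  interpret C: central_affine_curve "\<Gamma> p" by (rule central_affine[OF assms])
  show ?thesis
    unfolding frame_eq_G[OF assms, symmetric] by (rule frame_periodic[OF C.smooth], rule C.periodic)
qed

lemma R_periodic: "p \<in> U \<Longrightarrow> R a (p, x + 2 * pi) = R a (p, x)"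
  unfolding R_def M_def using dderiv_periodic[OF open_U smooth_G G_periodic] by (simp add: G_periodic)

text \<open>Differentiating the inverse gives
  \<open>(\<partial>_a \<partial>_b G) G^-1 - R b R a\<close>. The second-order part is symmetric in
  a and b, so antisymmetrizing leaves the commutator.\<close>

lemma R_maurer_cartan:
  assumes "z \<in> S"
  shows "dderiv (a, 0) (R b) z - dderiv (b, 0) (R a) z = R a z ** R b z - R b z ** R a z"
proof -
  have D: "dderiv (a, 0) (R b) z = dderiv (a, 0) (dderiv (b, 0) G) z ** M z - R b z ** R a z" for a b
  proof -
    have "dderiv (a, 0) (R b) z = dderiv (b, 0) G z ** dderiv (a, 0) M z + dderiv (a, 0) (dderiv (b, 0) G) z ** M z"
      unfolding R_def[abs_def]
      by (rule smooth_on_dderiv_bilinear[OF bounded_bilinear_matrix_mult smooth_on_dderiv[OF smooth_G] smooth_M assms])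
    also have "dderiv (a, 0) M z = - (M z ** dderiv (a, 0) G z ** M z)"
      unfolding M_def[abs_def] by (rule dderiv_matrix_inv[OF open_S smooth_G det_G assms])
    finally show ?thesis by (simp add: R_def[of _ z] matrix_mult_bilinear_simps matrix_mul_assoc)
  qed
  have "dderiv (a, 0) (dderiv (b, 0) G) z = dderiv (b, 0) (dderiv (a, 0) G) z"
    by (rule dderiv_commute[OF open_S smooth_G assms])
  then show ?thesis unfolding D[of a b] D[of b a] by simp
qed

definition H where "H a b z = trace (dderiv (0, 1) (R a) z ** R b z)"

lemma smooth_H: "smooth_on S (H a b)"
  unfolding H_def[abs_def]
  by (rule smooth_on_bilinear[OF open_S trace_matrix_mult_bilinear smooth_on_dderiv[OF smooth_R] smooth_R])

lemma pullback_eq: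
  assumes "p \<in> U"
  shows "pullback_form \<Gamma> w2_hat p a b = integral {0..2 * pi} (\<lambda>x. H a b (p, x))"
proof -
  interpret C: central_affine_curve "\<Gamma> p" by (rule central_affine[OF assms])
  have s: "smooth_on UNIV (variation \<Gamma> p a)"
    unfolding variation_eq[OF assms] by (rule smooth_on_slice[OF smooth_on_dderiv[OF smooth_\<Phi>] assms])
  have eta: "C.eta (variation \<Gamma> p a) = (\<lambda>x. R a (p, x))" for a
    by (rule ext) (simp add: C.eta_def C.N_def R_def M_def frame_variation[OF assms] frame_eq_G[OF assms])
  show ?thesis
    unfolding pullback_form_def C.w2_hat_eq[OF s] eta dderiv_slice[OF smooth_R assms] H_def ..
qed

lemma smooth_pullback: "smooth_on U (\<lambda>p. pullback_form \<Gamma> w2_hat p a b)"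
  by (rule smooth_on_cong[OF open_U _ smooth_on_integral_param[OF open_U smooth_H]])
    (rule pullback_eq[symmetric])

lemma frechet_derivative_pullback:
  assumes "p \<in> U"
  shows "frechet_derivative (\<lambda>q. pullback_form \<Gamma> w2_hat q b c) (at p) a =
    integral {0..2 * pi} (\<lambda>x. dderiv (a, 0) (H b c) (p, x))"
proof -
  have "dderiv a (\<lambda>q. pullback_form \<Gamma> w2_hat q b c) p = dderiv a (\<lambda>q. integral {0..2 * pi} (\<lambda>x. H b c (q, x))) p"
    by (rule dderiv_cong_open[OF open_U assms pullback_eq smooth_on_imp_differentiable[OF smooth_pullback assms]])
  also have "\<dots> = integral {0..2 * pi} (\<lambda>x. dderiv (a, 0) (H b c) (p, x))"
    by (rule dderiv_eq[OF has_derivative_integral_param[OF open_U smooth_H assms]])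
  finally show ?thesis by (simp add: dderiv_def)
qed

text \<open>A primitive in \<open>x\<close> of the integrand of \<open>d(\<Gamma>\<^sup>* w)(a, b, c)\<close>.\<close>

definition \<Theta> where
  "\<Theta> a b c z = trace (dderiv (a, 0) (R b) z ** R c z) + trace (dderiv (b, 0) (R c) z ** R a z)
     + trace (dderiv (c, 0) (R a) z ** R b z) + trace (R c z ** (R b z ** R a z - R a z ** R b z))"

text \<open>Interchanging x- and parameter derivatives makes the second-order terms on both sides
  coincide; what remains is the trace identity fed with three Maurer-Cartan equations.\<close>

lemma \<Theta>_has_vector_derivative:
  assumes "p \<in> U"
  shows "((\<lambda>x. \<Theta> a b c (p, x)) has_vector_derivative
    dderiv (a, 0) (H b c) (p, x) + dderiv (b, 0) (H c a) (p, x) + dderiv (c, 0) (H a b) (p, x)) (at x)"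
proof -
  have z: "(p, x) \<in> S" using assms by simp
  note sl = has_vector_derivative_slice[OF _ assms]
  note tb = bounded_bilinear.has_vector_derivative[OF trace_matrix_mult_bilinear]
  note mb = bounded_bilinear.has_vector_derivative[OF bounded_bilinear_matrix_mult]
  have HD: "dderiv (a, 0) (H b c) (p, x) = trace (dderiv (0, 1) (R b) (p, x) ** dderiv (a, 0) (R c) (p, x))
     + trace (dderiv (0, 1) (dderiv (a, 0) (R b)) (p, x) ** R c (p, x))" for a b c
    unfolding H_def[abs_def] smooth_on_dderiv_bilinear[OF trace_matrix_mult_bilinear smooth_on_dderiv[OF smooth_R] smooth_R z]
      dderiv_commute[OF open_S smooth_R z, of "(a, 0)"] ..
  note t1 = tb[OF sl[OF smooth_on_dderiv[OF smooth_R]] sl[OF smooth_R]]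
  note t2 = tb[OF sl[OF smooth_R] has_vector_derivative_diff[OF
      mb[OF sl[OF smooth_R] sl[OF smooth_R]] mb[OF sl[OF smooth_R] sl[OF smooth_R]]]]
  note mc = R_maurer_cartan[OF z]
  show ?thesis
    unfolding \<Theta>_def HD trace_cyclic_identity[OF mc mc mc]
    by (rule has_vector_derivative_add[OF has_vector_derivative_add[OF has_vector_derivative_add[OF t1 t1] t1] t2])
qed

lemma closed:
  assumes "p \<in> U"
  shows "frechet_derivative (\<lambda>q. pullback_form \<Gamma> w2_hat q b c) (at p) a +
    frechet_derivative (\<lambda>q. pullback_form \<Gamma> w2_hat q c a) (at p) b +
    frechet_derivative (\<lambda>q. pullback_form \<Gamma> w2_hat q a b) (at p) c = 0"
proof -
  have int: "(\<lambda>x. dderiv (a, 0) (H b c) (p, x)) integrable_on {0..2 * pi}" for a b c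
    using smooth_on_imp_continuous_on[OF smooth_on_slice[OF smooth_on_dderiv[OF smooth_H] assms]]
    by (intro integrable_continuous_interval) (rule continuous_on_subset, auto)
  have dR: "dderiv (a, 0) (R b) (p, 2 * pi) = dderiv (a, 0) (R b) (p, 0)" for a b
    using dderiv_periodic[OF open_U smooth_R R_periodic assms, of _ _ 0] by simp
  have R2: "R a (p, 2 * pi) = R a (p, 0)" for a
    using R_periodic[OF assms, of a 0] by simp
  \<comment> \<open>The primitive takes equal values at both ends, because \<open>R\<close> and its
    parameter derivatives are periodic in x.\<close>
  have "integral {0..2 * pi} (\<lambda>x. dderiv (a, 0) (H b c) (p, x) + dderiv (b, 0) (H c a) (p, x) + dderiv (c, 0) (H a b) (p, x)) = 0"
    by (rule integral_derivative_periodic[OF \<Theta>_has_vector_derivative[OF assms]]) (simp_all add: \<Theta>_def dR R2)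
  then show ?thesis
    unfolding frechet_derivative_pullback[OF assms]
    by (simp add: integral_add int integrable_add)
qed

end

theorem theorem6p12:
  assumes "CARD('n::{finite,linorder}) \<ge> 2"
  shows "induces_weak_symplectic_form (w2_hat :: 'n curve_form)"
proof -
  have "is_two_form (w2_hat :: 'n curve_form)"
    unfolding is_two_form_def
  proof (intro conjI ballI allI impI)
    fix \<gamma> v\<^sub>1 v\<^sub>2 v\<^sub>3 :: "'n curve" and c d
    assume "\<gamma> \<in> central_affine_curves"
    then interpret central_affine_curve \<gamma> by unfold_locales
    assume v: "v\<^sub>1 \<in> tangent_at \<gamma>" "v\<^sub>2 \<in> tangent_at \<gamma>" "v\<^sub>3 \<in> tangent_at \<gamma>"
    then have l: "smooth_loop v\<^sub>1" "smooth_loop v\<^sub>2" "smooth_loop v\<^sub>3"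
      by (simp_all add: mem_tangent_at_iff)
    show "w2_hat \<gamma> (\<lambda>x. c *\<^sub>R v\<^sub>1 x + d *\<^sub>R v\<^sub>2 x) v\<^sub>3 = c * w2_hat \<gamma> v\<^sub>1 v\<^sub>3 + d * w2_hat \<gamma> v\<^sub>2 v\<^sub>3"
      and "w2_hat \<gamma> v\<^sub>1 v\<^sub>2 = - w2_hat \<gamma> v\<^sub>2 v\<^sub>1"
      by (rule w2_hat_linear; use l in \<open>simp add: smooth_loop_def\<close>) (rule w2_hat_skew[OF l(1,2)])
  next
    fix U and \<Gamma> :: "real^3 \<Rightarrow> 'n curve" and a b
    assume "smooth_family U \<Gamma>"
    then interpret curve_family U \<Gamma> by unfold_locales
    show "smooth_on U (\<lambda>p. pullback_form \<Gamma> w2_hat p a b)" by (rule smooth_pullback)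
  qed
  moreover have "\<forall>U \<Gamma>. smooth_family U \<Gamma> \<longrightarrow> (\<forall>p\<in>U. \<forall>a b c.
        frechet_derivative (\<lambda>q. pullback_form \<Gamma> (w2_hat :: 'n curve_form) q b c) (at p) a +
        frechet_derivative (\<lambda>q. pullback_form \<Gamma> w2_hat q c a) (at p) b +
        frechet_derivative (\<lambda>q. pullback_form \<Gamma> w2_hat q a b) (at p) c = 0)"
  proof (intro allI impI ballI)
    fix U and \<Gamma> :: "real^3 \<Rightarrow> 'n curve" and p a b c
    assume "smooth_family U \<Gamma>" and p: "p \<in> U"
    then interpret curve_family U \<Gamma> by unfold_locales
    show "frechet_derivative (\<lambda>q. pullback_form \<Gamma> w2_hat q b c) (at p) a +
        frechet_derivative (\<lambda>q. pullback_form \<Gamma> w2_hat q c a) (at p) b +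
        frechet_derivative (\<lambda>q. pullback_form \<Gamma> w2_hat q a b) (at p) c = 0"
      by (rule closed[OF p])
  qed
  ultimately show ?thesis
    unfolding induces_weak_symplectic_form_def is_closed_two_form_def
    using SL_invariant_w2_hat central_affine_curve.null_space_eq central_affine_curve.intro by blast
qed

end
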